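(* Let $\mathfrak g$ be a Kac--Moody algebra and let $\lambda\in\mathfrak h^*$. If the stabilizer of $\lambda$ in $W_{I_\lambda}$ is finite, then $$\operatorname{wt}L(\lambda)=W_{I_\lambda}\{\mu\in P^+_\lambda:\mu\leqslant\lambda\},$$ i.e. $\operatorname{wt}L(\lambda)$ is the set of all $w\mu$ with $w\in W_{I_\lambda}$, $\mu\in P_\lambda^+$ and $\mu\leqslant\lambda$.
   Context: Let $I$ be a finite set, $A=(a_{ij})_{i,j\in I}$ a generalized Cartan matrix, and $(\mathfrak h,\{\alpha_i\},\{\check\alpha_i\})$ a realization over $\mathbb C$, i.e. $\dim\mathfrak h=2|I|-\operatorname{rk}A$, with linearly independent simple roots $\alpha_i\in\mathfrak h^*$ and linearly independent simple coroots $\check\alpha_i\in\mathfrak h$ with $\langle\check\alpha_i,\alpha_j\rangle=a_{ij}$. $\mathfrak g=\mathfrak g(A)$ is the Lie algebra generated by $\mathfrak h$ and $e_i,f_i$ ($i\in I$) with relations $[\mathfrak h,\mathfrak h]=0$, $[h,e_i]=\langle h,\alpha_i\rangle e_i$, $[h,f_i]=-\langle h,\alpha_i\rangle f_i$, $[e_i,f_j]=\delta_{ij}\check\alpha_i$ and the Serre relations $(\operatorname{ad}e_i)^{1-a_{ij}}e_j=0=(\operatorname{ad}f_i)^{1-a_{ij}}f_j$ for $i\ne j$. For an $\mathfrak h$-module $M$ and $\mu\in\mathfrak h^*$, $M_\mu=\{m: hm=\langle h,\mu\rangle m\ \forall h\in\mathfrak h\}$ and $\operatorname{wt}M=\{\mu: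 M_\mu\neq0\}$. $L(\lambda)$ is the simple highest weight $\mathfrak g$-module with highest weight $\lambda$. $I_\lambda=\{i\in I:\langle\check\alpha_i,\lambda\rangle\in\mathbb Z^{\geqslant0}\}$. $W_{I_\lambda}$ is the subgroup of the Weyl group generated by the simple reflections $s_i$, $i\in I_\lambda$, where $s_i\mu=\mu-\langle\check\alpha_i,\mu\rangle\alpha_i$ on $\mathfrak h^*$. $P^+_\lambda=\{\mu\in\mathfrak h^*:\langle\check\alpha_i,\mu\rangle\in\mathbb Z^{\geqslant0}\ \forall i\in I_\lambda\}$. $\mu\leqslant\lambda$ means $\lambda-\mu\in\mathbb Z^{\geqslant0}\{\alpha_i:i\in I\}$. *)

theory Defs
  imports
    Complex_Main
    "HOL-Library.Function_Algebras"
    "HOL-Algebra.Bij"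
    "HOL-Algebra.Generated_Groups"
begin

section \<open>Lie algebras and their modules over the complex numbers\<close>

locale lie_algebra = vector_space scale
  for scale :: "complex \<Rightarrow> 'g::ab_group_add \<Rightarrow> 'g" +
  fixes bracket :: "'g \<Rightarrow> 'g \<Rightarrow> 'g"
  assumes bracket_linear_left: "Vector_Spaces.linear scale scale (\<lambda>x. bracket x y)"
    and bracket_linear_right: "Vector_Spaces.linear scale scale (bracket x)"
    and bracket_alternating: "bracket x x = 0"
    and jacobi: "bracket x (bracket y z) + bracket y (bracket z x) + bracket z (bracket x y) = 0"

locale lie_module =
  g: lie_algebra gscale bracket + M: vector_space mscale
  for gscale :: "complex \<Rightarrow> 'g::ab_group_add \<Rightarrow> 'g"
    and bracket :: "'g \<Rightarrow> 'g \<Rightarrow> 'g"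
    and mscale :: "complex \<Rightarrow> 'm::ab_group_add \<Rightarrow> 'm" +
  fixes act :: "'g \<Rightarrow> 'm \<Rightarrow> 'm"
  assumes act_linear_left: "Vector_Spaces.linear gscale mscale (\<lambda>x. act x m)"
    and act_linear_right: "Vector_Spaces.linear mscale mscale (act x)"
    and act_bracket: "act (bracket x y) m = act x (act y m) - act y (act x m)"

definition submodule ::
  "(complex \<Rightarrow> 'm::ab_group_add \<Rightarrow> 'm) \<Rightarrow> ('g \<Rightarrow> 'm \<Rightarrow> 'm) \<Rightarrow> 'm set \<Rightarrow> bool" where
  "submodule mscale act N \<longleftrightarrow> module.subspace mscale N \<and> (\<forall>x. \<forall>m\<in>N. act x m \<in> N)"

definition simple_module ::
  "(complex \<Rightarrow> 'm::ab_group_add \<Rightarrow> 'm) \<Rightarrow> ('g \<Rightarrow> 'm \<Rightarrow> 'm) \<Rightarrow> bool" where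
  "simple_module mscale act \<longleftrightarrow>
     (UNIV :: 'm set) \<noteq> {0} \<and> (\<forall>N. submodule mscale act N \<longrightarrow> N = {0} \<or> N = UNIV)"


section \<open>Lie algebras given by generators and relations\<close>

datatype (gens: 'x) lie_term =
    Gen 'x
  | Zero
  | Add "'x lie_term" "'x lie_term"
  | Scale complex "'x lie_term"
  | Br "'x lie_term" "'x lie_term"

text \<open>
  \<open>lie_cong R s t\<close>: the identity \<open>s = t\<close> follows from the relations in \<open>R\<close> and the axioms of a
  complex Lie algebra. The classes of terms modulo this congruence form the Lie algebra
  presented by \<open>R\<close>.
\<close>

inductive lie_cong :: "('x lie_term \<times> 'x lie_term) set \<Rightarrow> 'x lie_term \<Rightarrow> 'x lie_term \<Rightarrow> bool"
  for R :: "('x lie_term \<times> 'x lie_term) set" where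
  relation: "(s, t) \<in> R \<Longrightarrow> lie_cong R s t"
| refl: "lie_cong R t t"
| sym: "lie_cong R s t \<Longrightarrow> lie_cong R t s"
| trans: "lie_cong R s t \<Longrightarrow> lie_cong R t u \<Longrightarrow> lie_cong R s u"
| Add: "lie_cong R s s' \<Longrightarrow> lie_cong R t t' \<Longrightarrow> lie_cong R (Add s t) (Add s' t')"
| Scale: "lie_cong R t t' \<Longrightarrow> lie_cong R (Scale c t) (Scale c t')"
| Br: "lie_cong R s s' \<Longrightarrow> lie_cong R t t' \<Longrightarrow> lie_cong R (Br s t) (Br s' t')"
| add_assoc: "lie_cong R (Add (Add s t) u) (Add s (Add t u))"
| add_commute: "lie_cong R (Add s t) (Add t s)"
| add_zero: "lie_cong R (Add Zero t) t"
| add_uminus: "lie_cong R (Add t (Scale (- 1) t)) Zero"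
| scale_add_right: "lie_cong R (Scale c (Add s t)) (Add (Scale c s) (Scale c t))"
| scale_add_left: "lie_cong R (Scale (c + d) t) (Add (Scale c t) (Scale d t))"
| scale_scale: "lie_cong R (Scale c (Scale d t)) (Scale (c * d) t)"
| scale_one: "lie_cong R (Scale 1 t) t"
| br_add_left: "lie_cong R (Br (Add s t) u) (Add (Br s u) (Br t u))"
| br_add_right: "lie_cong R (Br u (Add s t)) (Add (Br u s) (Br u t))"
| br_scale_left: "lie_cong R (Br (Scale c s) t) (Scale c (Br s t))"
| br_scale_right: "lie_cong R (Br s (Scale c t)) (Scale c (Br s t))"
| br_self: "lie_cong R (Br t t) Zero"
| br_jacobi: "lie_cong R (Add (Br s (Br t u)) (Add (Br t (Br u s)) (Br u (Br s t)))) Zero"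

primrec lie_eval ::
  "(complex \<Rightarrow> 'g::ab_group_add \<Rightarrow> 'g) \<Rightarrow> ('g \<Rightarrow> 'g \<Rightarrow> 'g) \<Rightarrow> ('x \<Rightarrow> 'g) \<Rightarrow> 'x lie_term \<Rightarrow> 'g" where
  "lie_eval scale bracket v (Gen x) = v x"
| "lie_eval scale bracket v Zero = 0"
| "lie_eval scale bracket v (Add s t) =
     lie_eval scale bracket v s + lie_eval scale bracket v t"
| "lie_eval scale bracket v (Scale c t) = scale c (lie_eval scale bracket v t)"
| "lie_eval scale bracket v (Br s t) =
     bracket (lie_eval scale bracket v s) (lie_eval scale bracket v t)"

text \<open>
  The Lie algebra with operations \<open>scale\<close>, \<open>bracket\<close> is presented by the generators \<open>v x\<close>, \<open>x \<in> X\<close>, and the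
  relations \<open>R\<close>: every element is a Lie expression in the generators, and two such
  expressions agree exactly if this follows from \<open>R\<close>. Evaluation of terms thus induces an
  isomorphism from the terms over \<open>X\<close> modulo the congruence onto the algebra.
\<close>

definition lie_presentation ::
  "(complex \<Rightarrow> 'g::ab_group_add \<Rightarrow> 'g) \<Rightarrow> ('g \<Rightarrow> 'g \<Rightarrow> 'g) \<Rightarrow> 'x set \<Rightarrow>
    ('x lie_term \<times> 'x lie_term) set \<Rightarrow> ('x \<Rightarrow> 'g) \<Rightarrow> bool" where
  "lie_presentation scale bracket X R v \<longleftrightarrow>
     lie_algebra scale bracket \<and>
     (\<forall>y. \<exists>t. gens t \<subseteq> X \<and> y = lie_eval scale bracket v t) \<and>
     (\<forall>s t. gens s \<subseteq> X \<longrightarrow> gens t \<subseteq> X \<longrightarrow>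
        (lie_eval scale bracket v s = lie_eval scale bracket v t \<longleftrightarrow> lie_cong R s t))"


section \<open>Generalized Cartan matrices and realizations\<close>

definition generalized_cartan_matrix :: "'i set \<Rightarrow> ('i \<Rightarrow> 'i \<Rightarrow> int) \<Rightarrow> bool" where
  "generalized_cartan_matrix I A \<longleftrightarrow>
     (\<forall>i\<in>I. A i i = 2) \<and>
     (\<forall>i\<in>I. \<forall>j\<in>I. i \<noteq> j \<longrightarrow> A i j \<le> 0) \<and>
     (\<forall>i\<in>I. \<forall>j\<in>I. A i j = 0 \<longrightarrow> A j i = 0)"

definition fun_scale :: "complex \<Rightarrow> ('a \<Rightarrow> complex) \<Rightarrow> 'a \<Rightarrow> complex" where
  "fun_scale c f = (\<lambda>x. c * f x)"

lemma vector_space_fun_scale: "vector_space fun_scale"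
  by unfold_locales (auto simp: fun_scale_def fun_eq_iff algebra_simps)

text \<open>The rank is the dimension of the row space; rows are extended by \<open>0\<close> outside \<open>I\<close>.\<close>

definition matrix_rank :: "'i set \<Rightarrow> ('i \<Rightarrow> 'i \<Rightarrow> int) \<Rightarrow> nat" where
  "matrix_rank I A =
     vector_space.dim fun_scale ((\<lambda>i j. if j \<in> I then of_int (A i j) else 0) ` I)"

definition dual_space :: "(complex \<Rightarrow> 'h::ab_group_add \<Rightarrow> 'h) \<Rightarrow> ('h \<Rightarrow> complex) set" where
  "dual_space hscale = {\<mu>. Vector_Spaces.linear hscale (*) \<mu>}"

text \<open>
  \<open>vector_space.dim\<close> is \<open>0\<close> on infinite-dimensional spaces, hence the separate
  finiteness assumption on \<open>\<hh>\<close>.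
\<close>

locale realization = H: vector_space hscale
  for hscale :: "complex \<Rightarrow> 'h::ab_group_add \<Rightarrow> 'h" +
  fixes I :: "'i set"
    and A :: "'i \<Rightarrow> 'i \<Rightarrow> int"
    and \<alpha> :: "'i \<Rightarrow> 'h \<Rightarrow> complex"
    and coroot :: "'i \<Rightarrow> 'h"
  assumes finite_I: "finite I"
    and gcm: "generalized_cartan_matrix I A"
    and finite_dim: "\<exists>B. finite B \<and> H.span B = UNIV"
    and dim_h: "H.dim UNIV + matrix_rank I A = 2 * card I"
    and root_in_dual: "i \<in> I \<Longrightarrow> \<alpha> i \<in> dual_space hscale"
    and roots_inj: "inj_on \<alpha> I"
    and roots_independent: "\<not> module.dependent fun_scale (\<alpha> ` I)"
    and coroots_inj: "inj_on coroot I"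
    and coroots_independent: "H.independent (coroot ` I)"
    and pairing: "i \<in> I \<Longrightarrow> j \<in> I \<Longrightarrow> \<alpha> j (coroot i) = of_int (A i j)"


section \<open>Kac--Moody algebras\<close>

datatype ('h, 'i) km_gen = Hg 'h | Eg 'i | Fg 'i

definition km_gens :: "'i set \<Rightarrow> ('h, 'i) km_gen set" where
  "km_gens I = range Hg \<union> Eg ` I \<union> Fg ` I"

text \<open>
  Generation by the vector space \<open>\<hh>\<close> means that the linear structure of \<open>\<hh>\<close> is part
  of the relations; this is the role of the first two families.
\<close>

definition km_relations ::
  "(complex \<Rightarrow> 'h::ab_group_add \<Rightarrow> 'h) \<Rightarrow> 'i set \<Rightarrow> ('i \<Rightarrow> 'i \<Rightarrow> int) \<Rightarrow> ('i \<Rightarrow> 'h \<Rightarrow> complex) \<Rightarrow>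
    ('i \<Rightarrow> 'h) \<Rightarrow> (('h, 'i) km_gen lie_term \<times> ('h, 'i) km_gen lie_term) set" where
  "km_relations hscale I A \<alpha> coroot =
     (let h = \<lambda>x. Gen (Hg x); e = \<lambda>i. Gen (Eg i); f = \<lambda>i. Gen (Fg i) in
       {(h (x + y), Add (h x) (h y)) | x y. True}
     \<union> {(h (hscale c x), Scale c (h x)) | c x. True}
     \<union> {(Br (h x) (h y), Zero) | x y. True}
     \<union> {(Br (h x) (e i), Scale (\<alpha> i x) (e i)) | x i. i \<in> I}
     \<union> {(Br (h x) (f i), Scale (- \<alpha> i x) (f i)) | x i. i \<in> I}
     \<union> {(Br (e i) (f i), h (coroot i)) | i. i \<in> I}
     \<union> {(Br (e i) (f j), Zero) | i j. i \<in> I \<and> j \<in> I \<and> i \<noteq> j}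
     \<union> {((Br (e i) ^^ nat (1 - A i j)) (e j), Zero) | i j. i \<in> I \<and> j \<in> I \<and> i \<noteq> j}
     \<union> {((Br (f i) ^^ nat (1 - A i j)) (f j), Zero) | i j. i \<in> I \<and> j \<in> I \<and> i \<noteq> j})"

text \<open>\<open>hmap\<close> is the canonical map from \<open>\<hh>\<close> to \<open>\<gg>(A)\<close>; \<open>e\<close>, \<open>f\<close> are the Chevalley generators.\<close>

locale kac_moody_algebra = realization hscale I A \<alpha> coroot
  for hscale :: "complex \<Rightarrow> 'h::ab_group_add \<Rightarrow> 'h"
    and I :: "'i set"
    and A :: "'i \<Rightarrow> 'i \<Rightarrow> int"
    and \<alpha> :: "'i \<Rightarrow> 'h \<Rightarrow> complex"
    and coroot :: "'i \<Rightarrow> 'h" +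
  fixes gscale :: "complex \<Rightarrow> 'g::ab_group_add \<Rightarrow> 'g"
    and bracket :: "'g \<Rightarrow> 'g \<Rightarrow> 'g"
    and hmap :: "'h \<Rightarrow> 'g"
    and e :: "'i \<Rightarrow> 'g"
    and f :: "'i \<Rightarrow> 'g"
  assumes presentation:
    "lie_presentation gscale bracket (km_gens I) (km_relations hscale I A \<alpha> coroot)
       (case_km_gen hmap e f)"


section \<open>Weights and highest weight modules\<close>

definition weight_space ::
  "(complex \<Rightarrow> 'm::ab_group_add \<Rightarrow> 'm) \<Rightarrow> ('h \<Rightarrow> 'm \<Rightarrow> 'm) \<Rightarrow> ('h \<Rightarrow> complex) \<Rightarrow> 'm set" where
  "weight_space mscale hact \<mu> = {m. \<forall>x. hact x m = mscale (\<mu> x) m}"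

definition weights ::
  "(complex \<Rightarrow> 'h::ab_group_add \<Rightarrow> 'h) \<Rightarrow> (complex \<Rightarrow> 'm::ab_group_add \<Rightarrow> 'm) \<Rightarrow>
    ('h \<Rightarrow> 'm \<Rightarrow> 'm) \<Rightarrow> ('h \<Rightarrow> complex) set" where
  "weights hscale mscale hact =
     {\<mu> \<in> dual_space hscale. weight_space mscale hact \<mu> \<noteq> {0}}"

text \<open>
  Annihilation of \<open>v\<close> by the \<open>e i\<close> is annihilation by the positive part, which they generate.
\<close>

definition highest_weight_module ::
  "'i set \<Rightarrow> ('h \<Rightarrow> 'g) \<Rightarrow> ('i \<Rightarrow> 'g) \<Rightarrow> (complex \<Rightarrow> 'm::ab_group_add \<Rightarrow> 'm) \<Rightarrow> ('g \<Rightarrow> 'm \<Rightarrow> 'm) \<Rightarrow>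
    ('h \<Rightarrow> complex) \<Rightarrow> bool" where
  "highest_weight_module I hmap e mscale act \<Lambda> \<longleftrightarrow>
     (\<exists>v. v \<noteq> 0 \<and> v \<in> weight_space mscale (\<lambda>x. act (hmap x)) \<Lambda> \<and>
        (\<forall>i\<in>I. act (e i) v = 0) \<and>
        (\<forall>N. submodule mscale act N \<longrightarrow> v \<in> N \<longrightarrow> N = UNIV))"


section \<open>Weyl group, integrability and dominance\<close>

definition simple_reflection ::
  "(complex \<Rightarrow> 'h::ab_group_add \<Rightarrow> 'h) \<Rightarrow> ('i \<Rightarrow> 'h \<Rightarrow> complex) \<Rightarrow> ('i \<Rightarrow> 'h) \<Rightarrow> 'i \<Rightarrow>
    ('h \<Rightarrow> complex) \<Rightarrow> ('h \<Rightarrow> complex)" where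
  "simple_reflection hscale \<alpha> coroot i =
     (\<lambda>\<mu>\<in>dual_space hscale. \<mu> - fun_scale (\<mu> (coroot i)) (\<alpha> i))"

text \<open>
  \<open>W\<^sub>J\<close> as a group of permutations of \<open>\<hh>\<^sup>*\<close>, generated by the \<open>s\<^sub>i\<close> with \<open>i \<in> J\<close>.
\<close>

definition parabolic_weyl_group ::
  "(complex \<Rightarrow> 'h::ab_group_add \<Rightarrow> 'h) \<Rightarrow> ('i \<Rightarrow> 'h \<Rightarrow> complex) \<Rightarrow> ('i \<Rightarrow> 'h) \<Rightarrow> 'i set \<Rightarrow>
    (('h \<Rightarrow> complex) \<Rightarrow> ('h \<Rightarrow> complex)) set" where
  "parabolic_weyl_group hscale \<alpha> coroot J =
     generate (BijGroup (dual_space hscale)) (simple_reflection hscale \<alpha> coroot ` J)"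

definition integrable_indices :: "'i set \<Rightarrow> ('i \<Rightarrow> 'h) \<Rightarrow> ('h \<Rightarrow> complex) \<Rightarrow> 'i set" where
  "integrable_indices I coroot \<Lambda> = {i \<in> I. \<Lambda> (coroot i) \<in> \<nat>}"

definition dominant_for ::
  "(complex \<Rightarrow> 'h::ab_group_add \<Rightarrow> 'h) \<Rightarrow> ('i \<Rightarrow> 'h) \<Rightarrow> 'i set \<Rightarrow> ('h \<Rightarrow> complex) set" where
  "dominant_for hscale coroot J = {\<mu> \<in> dual_space hscale. \<forall>i\<in>J. \<mu> (coroot i) \<in> \<nat>}"

definition weight_le ::
  "'i set \<Rightarrow> ('i \<Rightarrow> 'h \<Rightarrow> complex) \<Rightarrow> ('h \<Rightarrow> complex) \<Rightarrow> ('h \<Rightarrow> complex) \<Rightarrow> bool" where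
  "weight_le I \<alpha> \<mu> \<Lambda> \<longleftrightarrow>
     (\<exists>n :: 'i \<Rightarrow> nat. \<Lambda> - \<mu> = (\<Sum>i\<in>I. fun_scale (of_nat (n i)) (\<alpha> i)))"

end

theory Submission
  imports Defs
begin

text \<open>
  The operators \<open>f i\<close> are locally nilpotent on \<open>L(\<Lambda>)\<close> for \<open>i \<in> I\<^sub>\<Lambda>\<close> and injective for the other
  \<open>i\<close>, because the vectors on which \<open>f i\<close> is nilpotent form a submodule. Hence the weights are stable
  under \<open>W\<close> of \<open>I\<^sub>\<Lambda>\<close>, and every orbit of weights contains a dominant one, namely one of minimal
  depth below \<open>\<Lambda>\<close>. That a dominant \<open>\<mu> \<le> \<Lambda>\<close> is a weight is shown by going down from \<open>\<Lambda>\<close> towards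
  \<open>\<mu>\<close> as far as possible. Getting stuck produces a nonzero nonnegative combination of simple
  roots orthogonal to \<open>\<Lambda>\<close> whose pairings with the corresponding coroots are nonpositive; a form
  invariant under the finite stabilizer of \<open>\<Lambda>\<close> excludes this.
\<close>

section \<open>A ratio argument for generalized Cartan matrices\<close>

text \<open>The obstacle is that \<open>A\<close> need not be symmetrizable, so no form invariant
  under the whole Weyl group is at hand. Averaging over the stabilizer only gives invariance under
  those simple reflections that fix \<open>\<Lambda>\<close>. The defect \<open>b\<close> may well
  involve simple roots that are not orthogonal to \<open>\<Lambda>\<close>, and about these the
  averaged form says nothing; the defect therefore has to be cut down before the form can be
  applied. The ratio argument does this cutting. It is the mechanism behind the trichotomy
  finite/affine/indefinite of indecomposable generalized Cartan matrices: a positive vector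
  \<open>b\<close> with \<open>A b \<le> 0\<close> leaves a nonnegative vector \<open>m\<close> with
  \<open>A m \<ge> 0\<close> no freedom where \<open>m / b\<close> is minimal. There
  \<open>m\<close> is proportional to \<open>b\<close>, the rows of \<open>A m\<close> vanish, and
  the block is decoupled from the rest of the support, so truncating \<open>b\<close> to it keeps
  the pairings nonpositive.\<close>

text \<open>The set \<open>Z\<close> consists of the indices where the ratio \<open>m i / b i\<close> is minimal.\<close>

lemma minimal_ratio_block:
  fixes a :: "'i \<Rightarrow> 'i \<Rightarrow> real" and b m :: "'i \<Rightarrow> real"
  assumes fin: "finite D" and ne: "D \<noteq> {}"
    and off_diagonal: "\<And>i j. i \<in> D \<Longrightarrow> j \<in> D \<Longrightarrow> i \<noteq> j \<Longrightarrow> a i j \<le> 0"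
    and m: "\<And>i. i \<in> D \<Longrightarrow> m i \<ge> 0" and b: "\<And>i. i \<in> D \<Longrightarrow> b i > 0"
    and ab: "\<And>i. i \<in> D \<Longrightarrow> (\<Sum>j\<in>D. a i j * b j) \<le> 0"
    and am: "\<And>i. i \<in> D \<Longrightarrow> (\<Sum>j\<in>D. a i j * m j) \<ge> 0"
  obtains Z where "Z \<subseteq> D" "Z \<noteq> {}" "\<And>i j. i \<in> Z \<Longrightarrow> j \<in> D - Z \<Longrightarrow> a i j = 0"
    "\<And>i. i \<in> Z \<Longrightarrow> (\<Sum>j\<in>D. a i j * m j) = 0"
proof -
  define t where "t = Min ((\<lambda>i. m i / b i) ` D)"
  have t_le: "t \<le> m i / b i" if "i \<in> D" for i
    using fin that by (simp add: t_def)
  have "t \<in> (\<lambda>i. m i / b i) ` D"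
    unfolding t_def by (rule Min_in) (use fin ne in auto)
  then obtain i0 where i0: "i0 \<in> D" "t = m i0 / b i0" by blast
  have t0: "t \<ge> 0"
    using i0 m[OF i0(1)] b[OF i0(1)] by simp
  define x where "x i = m i - t * b i" for i
  have x0: "x i \<ge> 0" if "i \<in> D" for i
    using t_le[OF that] b[OF that] by (simp add: x_def pos_le_divide_eq)
  define Z where "Z = {i \<in> D. x i = 0}"
  have x_sum: "(\<Sum>j\<in>D. a i j * x j) = (\<Sum>j\<in>D. a i j * m j) - t * (\<Sum>j\<in>D. a i j * b j)" for i
    by (simp add: x_def algebra_simps sum_subtractf sum_distrib_left)
  \<comment> \<open>For \<open>i\<close> in \<open>Z\<close> the sum of the
    \<open>a i j * x j\<close> is squeezed to 0. It has no positive term, since the diagonal one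
    carries the factor \<open>x i = 0\<close>; by \<open>x_sum\<close> it is also a nonnegative
    number minus a nonpositive one. Hence every term vanishes, and so do both parts of
    \<open>x_sum\<close>.\<close>
  have key: "(\<forall>j\<in>D. a i j * x j = 0) \<and> (\<Sum>j\<in>D. a i j * m j) = 0" if i: "i \<in> Z" for i
  proof -
    have iD: "i \<in> D" using i by (simp add: Z_def)
    have le: "a i j * x j \<le> 0" if "j \<in> D" for j
      using i off_diagonal[OF iD that] x0[OF that]
      by (cases "j = i") (auto simp: Z_def mult_nonpos_nonneg)
    have tb: "t * (\<Sum>j\<in>D. a i j * b j) \<le> 0"
      using t0 ab[OF iD] by (simp add: mult_nonneg_nonpos)
    have s0: "(\<Sum>j\<in>D. a i j * x j) \<le> 0"
      using le by (rule sum_nonpos)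
    have s: "(\<Sum>j\<in>D. a i j * x j) = 0"
      using s0 tb am[OF iD] x_sum[of i] by linarith
    have "(\<Sum>j\<in>D. - (a i j * x j)) = 0"
      using s by (simp add: sum_negf)
    then have "\<forall>j\<in>D. - (a i j * x j) = 0"
      using sum_nonneg_eq_0_iff[OF fin, of "\<lambda>j. - (a i j * x j)"] le by simp
    moreover have "(\<Sum>j\<in>D. a i j * m j) = 0"
      using s tb am[OF iD] x_sum[of i] by linarith
    ultimately show ?thesis by simp
  qed
  show ?thesis
  proof (rule that)
    show "Z \<subseteq> D" by (auto simp: Z_def)
    show "Z \<noteq> {}" using i0 b[OF i0(1)] by (auto simp: Z_def x_def)
    show "a i j = 0" if "i \<in> Z" "j \<in> D - Z" for i j
      using key[OF that(1)] that(2) by (auto simp: Z_def)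
    show "(\<Sum>j\<in>D. a i j * m j) = 0" if "i \<in> Z" for i
      using key[OF that] by simp
  qed
qed

section \<open>The Weyl group\<close>

lemma fun_scale_apply [simp]: "fun_scale c g x = c * g x"
  by (simp add: fun_scale_def)

lemma sum_fun_apply: "(\<Sum>i\<in>S. g i) x = (\<Sum>i\<in>S. g i x)"
  for g :: "'a \<Rightarrow> 'b \<Rightarrow> 'c::comm_monoid_add"
  by (induction S rule: infinite_finite_induct) auto

context realization
begin

abbreviation dual :: "('h \<Rightarrow> complex) set" where
  "dual \<equiv> dual_space hscale"

abbreviation refl :: "'i \<Rightarrow> ('h \<Rightarrow> complex) \<Rightarrow> 'h \<Rightarrow> complex" where
  "refl \<equiv> simple_reflection hscale \<alpha> coroot"

abbreviation weyl :: "'i set \<Rightarrow> (('h \<Rightarrow> complex) \<Rightarrow> 'h \<Rightarrow> complex) set" where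
  "weyl \<equiv> parabolic_weyl_group hscale \<alpha> coroot"

section \<open>Combinations of simple roots and their coefficients\<close>

definition root_comb :: "('i \<Rightarrow> complex) \<Rightarrow> 'h \<Rightarrow> complex" where
  "root_comb c = (\<Sum>i\<in>I. fun_scale (c i) (\<alpha> i))"

lemma root_comb_apply: "root_comb c x = (\<Sum>i\<in>I. c i * \<alpha> i x)"
  by (simp add: root_comb_def sum_fun_apply)

lemma root_comb_add: "root_comb (\<lambda>i. c i + d i) = root_comb c + root_comb d"
  by (rule ext) (simp add: root_comb_apply algebra_simps sum.distrib)

lemma root_comb_diff: "root_comb (\<lambda>i. c i - d i) = root_comb c - root_comb d"
  by (rule ext) (simp add: root_comb_apply algebra_simps sum_subtractf)

lemma root_comb_single:
  assumes "i \<in> I"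
  shows "root_comb (\<lambda>j. if j = i then c else 0) = fun_scale c (\<alpha> i)"
  by (rule ext) (use assms finite_I in \<open>simp add: root_comb_apply if_distrib[of "\<lambda>x. x * _"] cong: if_cong\<close>)

lemma root_comb_coroot: "i \<in> I \<Longrightarrow> root_comb c (coroot i) = (\<Sum>j\<in>I. c j * of_int (A i j))"
  by (simp add: root_comb_apply pairing)

lemma root_comb_eq_0_iff: "root_comb c = 0 \<longleftrightarrow> (\<forall>i\<in>I. c i = 0)"
proof
  assume 0: "root_comb c = 0"
  interpret F: vector_space fun_scale by (rule vector_space_fun_scale)
  have "(\<Sum>y\<in>\<alpha> ` I. fun_scale (c (the_inv_into I \<alpha> y)) y) = root_comb c"
    unfolding root_comb_def
    by (subst sum.reindex[OF roots_inj]) (simp add: the_inv_into_f_f[OF roots_inj])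
  then have "c (the_inv_into I \<alpha> y) = 0" if "y \<in> \<alpha> ` I" for y
    using F.independentD[OF roots_independent, of "\<alpha> ` I"] finite_I 0 that by simp
  then show "\<forall>i\<in>I. c i = 0"
    by (metis image_eqI roots_inj the_inv_into_f_f)
next
  assume "\<forall>i\<in>I. c i = 0"
  then show "root_comb c = 0"
    by (intro ext) (simp add: root_comb_apply)
qed

text \<open>Makes the coefficients of \<open>\<Lambda> - \<mu>\<close> unique; later comparisons of
  weights become comparisons of natural numbers.\<close>

lemma root_comb_eq_iff: "root_comb c = root_comb d \<longleftrightarrow> (\<forall>i\<in>I. c i = d i)"
  using root_comb_eq_0_iff[of "\<lambda>i. c i - d i"] by (simp add: root_comb_diff)

lemma weight_le_iff: "weight_le I \<alpha> \<mu> \<Lambda> \<longleftrightarrow> (\<exists>n. \<mu> = \<Lambda> - root_comb (\<lambda>i. of_nat (n i)))"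
proof -
  have "\<Lambda> - \<mu> = \<xi> \<longleftrightarrow> \<mu> = \<Lambda> - \<xi>" for \<xi> by (auto simp: algebra_simps)
  then show ?thesis unfolding weight_le_def root_comb_def by blast
qed

section \<open>The dual space and simple reflections\<close>

lemma dual_iff:
  "\<mu> \<in> dual \<longleftrightarrow> (\<forall>x y. \<mu> (x + y) = \<mu> x + \<mu> y) \<and> (\<forall>c x. \<mu> (hscale c x) = c * \<mu> x)"
proof -
  have "vector_space ((*) :: complex \<Rightarrow> _)"
    by unfold_locales (auto simp: algebra_simps)
  then show ?thesis
    by (simp add: dual_space_def Vector_Spaces.linear_iff H.vector_space_axioms)
qed

lemma dual_diff: "\<mu> \<in> dual \<Longrightarrow> \<nu> \<in> dual \<Longrightarrow> \<mu> - \<nu> \<in> dual"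
  by (simp add: dual_iff algebra_simps)

lemma dual_fun_scale: "\<mu> \<in> dual \<Longrightarrow> fun_scale c \<mu> \<in> dual"
  by (simp add: dual_iff algebra_simps)

lemma root_comb_dual: "root_comb c \<in> dual"
proof -
  have "\<And>i x y. i \<in> I \<Longrightarrow> \<alpha> i (x + y) = \<alpha> i x + \<alpha> i y"
    and "\<And>i k x. i \<in> I \<Longrightarrow> \<alpha> i (hscale k x) = k * \<alpha> i x"
    using root_in_dual by (auto simp: dual_iff)
  then show ?thesis
    by (simp add: dual_iff root_comb_apply algebra_simps sum.distrib sum_distrib_left)
qed

lemma refl_eq: "\<mu> \<in> dual \<Longrightarrow> refl i \<mu> = \<mu> - fun_scale (\<mu> (coroot i)) (\<alpha> i)"
  by (simp add: simple_reflection_def)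

lemma refl_dual: "i \<in> I \<Longrightarrow> \<mu> \<in> dual \<Longrightarrow> refl i \<mu> \<in> dual"
  by (simp add: refl_eq dual_diff dual_fun_scale root_in_dual)

lemma root_self: "i \<in> I \<Longrightarrow> \<alpha> i (coroot i) = 2"
  using gcm by (simp add: pairing generalized_cartan_matrix_def)

lemma refl_refl: "i \<in> I \<Longrightarrow> \<mu> \<in> dual \<Longrightarrow> refl i (refl i \<mu>) = \<mu>"
  by (rule ext) (simp add: refl_eq dual_diff dual_fun_scale root_in_dual root_self algebra_simps)

lemma refl_Bij:
  assumes "i \<in> I"
  shows "refl i \<in> Bij dual"
proof -
  have "bij_betw (refl i) dual dual"
    by (rule bij_betwI[where g = "refl i"]) (use assms in \<open>auto simp: refl_dual refl_refl\<close>)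
  moreover have "refl i \<in> extensional dual"
    unfolding simple_reflection_def by (rule restrict_extensional)
  ultimately show ?thesis by (simp add: Bij_def)
qed

lemma refl_compose_refl: "i \<in> I \<Longrightarrow> compose dual (refl i) (refl i) = (\<lambda>\<mu>\<in>dual. \<mu>)"
  by (rule ext) (simp add: compose_def refl_refl)

lemma inv_refl: "i \<in> I \<Longrightarrow> inv\<^bsub>BijGroup dual\<^esub> (refl i) = refl i"
  by (rule group.inv_equality[OF group_BijGroup])
    (simp_all add: BijGroup_def refl_Bij refl_compose_refl)

text \<open>Simple reflections are their own inverses, so the inverse case of
  \<open>generate\<close> is absorbed by \<open>refl\<close>. Membership in \<open>Bij\<close> is
  carried through the induction because the product of \<open>BijGroup\<close> is composition only
  there.\<close>

lemma weyl_induct [consumes 2, case_names one refl compose]: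
  assumes "w \<in> weyl J" and "J \<subseteq> I"
    and "P (\<lambda>\<mu>\<in>dual. \<mu>)"
    and "\<And>i. i \<in> J \<Longrightarrow> P (refl i)"
    and "\<And>u v. \<lbrakk>u \<in> weyl J; v \<in> weyl J; u \<in> Bij dual; v \<in> Bij dual; P u; P v\<rbrakk>
      \<Longrightarrow> P (compose dual u v)"
  shows "P w"
proof -
  have "w \<in> Bij dual \<and> P w"
    using assms(1) unfolding parabolic_weyl_group_def
  proof induction
    case one
    have "\<one>\<^bsub>BijGroup dual\<^esub> = (\<lambda>\<mu>\<in>dual. \<mu>)" by (simp add: BijGroup_def)
    then show ?case using assms(3) id_Bij[of dual] by metis
  next
    case (incl h)
    then show ?case using assms(2,4) refl_Bij by auto
  next
    case (inv h)
    then obtain i where "i \<in> J" "h = refl i" by auto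
    then have "inv\<^bsub>BijGroup dual\<^esub> h = refl i" "i \<in> J" "i \<in> I"
      using assms(2) inv_refl by auto
    then show ?case using assms(4) refl_Bij by simp
  next
    case (eng u v)
    then have "u \<otimes>\<^bsub>BijGroup dual\<^esub> v = compose dual u v"
      by (simp add: BijGroup_def)
    with eng show ?case
      using assms(5) by (simp add: parabolic_weyl_group_def compose_Bij)
  qed
  then show ?thesis by simp
qed

lemma weyl_Bij:
  assumes "w \<in> weyl J" "J \<subseteq> I"
  shows "w \<in> Bij dual"
  using assms
proof (induction rule: weyl_induct)
  case one
  show "(\<lambda>\<mu>\<in>dual. \<mu>) \<in> Bij dual" by (rule id_Bij)
next
  case (refl i)
  then show "refl i \<in> Bij dual" using assms(2) by (intro refl_Bij) auto
next
  case (compose u v)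
  then show "compose dual u v \<in> Bij dual" by (intro compose_Bij)
qed

lemma weyl_one: "(\<lambda>\<mu>\<in>dual. \<mu>) \<in> weyl J"
  using generate.one[of "BijGroup dual"] by (simp add: parabolic_weyl_group_def BijGroup_def)

lemma weyl_refl: "i \<in> J \<Longrightarrow> refl i \<in> weyl J"
  by (simp add: parabolic_weyl_group_def generate.incl)

lemma weyl_compose:
  assumes "J \<subseteq> I" "u \<in> weyl J" "v \<in> weyl J"
  shows "compose dual u v \<in> weyl J"
proof -
  have "u \<in> Bij dual" "v \<in> Bij dual" using assms weyl_Bij by auto
  then have "u \<otimes>\<^bsub>BijGroup dual\<^esub> v = compose dual u v" by (simp add: BijGroup_def)
  then show ?thesis
    using generate.eng[of u "BijGroup dual" _ v] assms by (simp add: parabolic_weyl_group_def)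
qed

lemma weyl_preserves:
  assumes "w \<in> weyl J" "J \<subseteq> I" "T \<subseteq> dual" "\<And>i \<mu>. i \<in> J \<Longrightarrow> \<mu> \<in> T \<Longrightarrow> refl i \<mu> \<in> T" "\<mu> \<in> T"
  shows "w \<mu> \<in> T"
  using assms(1,2,5)
  by (induction arbitrary: \<mu> rule: weyl_induct) (use assms(3,4) in \<open>auto simp: compose_def\<close>)

lemma weyl_dual:
  assumes "w \<in> weyl J" "J \<subseteq> I" "\<mu> \<in> dual"
  shows "w \<mu> \<in> dual"
  using assms(2) by (intro weyl_preserves[OF assms(1,2) subset_refl _ assms(3)] refl_dual) auto

text \<open>Linearity, packaged in the shape in which reflections occur.\<close>

lemma weyl_diff_scale:
  assumes "w \<in> weyl J" "J \<subseteq> I" "\<mu> \<in> dual" "\<nu> \<in> dual"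
  shows "w (\<mu> - fun_scale c \<nu>) = w \<mu> - fun_scale c (w \<nu>)"
  using assms
proof (induction arbitrary: \<mu> \<nu> rule: weyl_induct)
  case one
  then have "\<mu> - fun_scale c \<nu> \<in> dual" by (simp only: dual_diff dual_fun_scale)
  with one show "(\<lambda>\<mu>\<in>dual. \<mu>) (\<mu> - fun_scale c \<nu>) =
      (\<lambda>\<mu>\<in>dual. \<mu>) \<mu> - fun_scale c ((\<lambda>\<mu>\<in>dual. \<mu>) \<nu>)"
    by (simp only: restrict_apply if_True)
next
  case (refl i)
  then show "refl i (\<mu> - fun_scale c \<nu>) = refl i \<mu> - fun_scale c (refl i \<nu>)"
    by (intro ext) (simp add: refl_eq dual_diff dual_fun_scale algebra_simps)
next
  case (compose u v)
  have v: "v (\<mu> - fun_scale c \<nu>) = v \<mu> - fun_scale c (v \<nu>)"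
    by (rule compose.IH(2)) fact+
  have u: "u (v \<mu> - fun_scale c (v \<nu>)) = u (v \<mu>) - fun_scale c (u (v \<nu>))"
    by (rule compose.IH(1)) (intro weyl_dual[OF compose.hyps(2) assms(2)] compose.prems)+
  show "compose dual u v (\<mu> - fun_scale c \<nu>) =
      compose dual u v \<mu> - fun_scale c (compose dual u v \<nu>)"
    using compose.prems u v by (simp add: compose_def dual_diff dual_fun_scale)
qed

text \<open>
  Averaging over the finite stabilizer gives a positive definite form for which the reflections in
  the stabilizer are orthogonal, so \<open>\<mu> (coroot i)\<close> and the inner product of \<open>\<mu>\<close> with \<open>\<alpha> i\<close>
  have the same sign.
\<close>

lemma finite_stabilizer_positive:
  fixes b :: "'i \<Rightarrow> nat"
  assumes J: "J \<subseteq> I" and \<Lambda>: "\<Lambda> \<in> dual" and fin: "finite {w \<in> weyl J. w \<Lambda> = \<Lambda>}"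
    and b: "\<And>i. i \<in> I \<Longrightarrow> b i > 0 \<Longrightarrow>
      i \<in> J \<and> \<Lambda> (coroot i) = 0 \<and> (\<Sum>j\<in>I. A i j * int (b j)) \<le> 0"
    and i: "i \<in> I"
  shows "b i = 0"
proof -
  define G where "G = {w \<in> weyl J. w \<Lambda> = \<Lambda>}"
  obtain B where B: "finite B" "H.span B = UNIV" using finite_dim by blast
  \<comment> \<open>The set \<open>B\<close> spans the space of arguments: evaluation at
    \<open>B\<close> separates the elements of \<open>dual\<close>, which makes the summand of the
    identity already positive definite. Real parts keep the form real and symmetric.\<close>
  define form where "form \<mu> \<nu> = (\<Sum>w\<in>G. \<Sum>x\<in>B. Re (w \<mu> x * cnj (w \<nu> x)))" for \<mu> \<nu>
  have G_weyl: "w \<in> weyl J" if "w \<in> G" for w using that by (simp add: G_def)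
  have form_sym: "form \<mu> \<nu> = form \<nu> \<mu>" for \<mu> \<nu>
    by (simp add: form_def algebra_simps)
  have form_diff: "form (\<mu> - fun_scale (of_real r) \<nu>) \<xi> = form \<mu> \<xi> - r * form \<nu> \<xi>"
    if "\<mu> \<in> dual" "\<nu> \<in> dual" for \<mu> \<nu> \<xi> r
    by (simp add: form_def weyl_diff_scale[OF G_weyl J] that sum_subtractf sum_distrib_left
        algebra_simps)
  have form_sq: "form \<mu> \<mu> = (\<Sum>w\<in>G. \<Sum>x\<in>B. (cmod (w \<mu> x))\<^sup>2)" for \<mu>
    by (simp only: form_def complex_norm_square[symmetric] Re_complex_of_real of_real_power[symmetric])
  have form_nonneg: "form \<mu> \<mu> \<ge> 0" for \<mu>
    by (simp add: form_sq sum_nonneg)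
  have form_0: "\<mu> = 0" if \<mu>: "\<mu> \<in> dual" and 0: "form \<mu> \<mu> = 0" for \<mu>
  proof -
    have "(\<lambda>\<mu>\<in>dual. \<mu>) \<in> G" using \<Lambda> weyl_one by (simp add: G_def)
    then have "(\<Sum>x\<in>B. (cmod (\<mu> x))\<^sup>2) = 0"
      using 0 fin \<mu> unfolding form_sq
      by (subst (asm) sum_nonneg_eq_0_iff) (auto simp: G_def sum_nonneg)
    then have "\<mu> x = 0" if "x \<in> B" for x
      using B(1) that by (simp add: sum_nonneg_eq_0_iff)
    moreover have "Vector_Spaces.linear hscale (*) \<mu>"
      using \<mu> by (simp add: dual_space_def)
    ultimately have "\<mu> x = 0" for x
      using module_hom.eq_0_on_span[of hscale "(*)" \<mu> B x] B(2)
      by (simp add: Vector_Spaces.linear_iff_module_hom)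
    then show ?thesis by (simp add: fun_eq_iff)
  qed
  have form_refl: "form (refl i \<mu>) (refl i \<nu>) = form \<mu> \<nu>"
    if i: "i \<in> J" "\<Lambda> (coroot i) = 0" and \<mu>\<nu>: "\<mu> \<in> dual" "\<nu> \<in> dual" for i \<mu> \<nu>
  proof -
    have iI: "i \<in> I" using i J by auto
    have \<Lambda>i: "refl i \<Lambda> = \<Lambda>" using i by (simp add: refl_eq[OF \<Lambda>] fun_eq_iff)
    \<comment> \<open>Right translation by \<open>refl i\<close> is an involution of
      \<open>G\<close>; reindexing the average by it gives the invariance. Extensionality of group
      elements is what makes the double translate equal to \<open>w\<close> outside
      \<open>dual\<close> as well.\<close>
    have mem: "compose dual w (refl i) \<in> G" if "w \<in> G" for w
      using that weyl_compose[OF J _ weyl_refl[OF i(1)]] \<Lambda> \<Lambda>i by (simp add: G_def compose_def)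
    have twice: "compose dual (compose dual w (refl i)) (refl i) = w" if "w \<in> G" for w
    proof -
      have "w \<in> extensional dual"
        using weyl_Bij[OF G_weyl[OF that] J] by (simp add: Bij_def)
      then show ?thesis
        by (intro ext) (auto simp: compose_def restrict_def refl_dual iI refl_refl extensional_def)
    qed
    have bij: "bij_betw (\<lambda>w. compose dual w (refl i)) G G"
      by (rule bij_betwI[where g = "\<lambda>w. compose dual w (refl i)"]) (auto simp: mem twice)
    have "form \<mu> \<nu> = (\<Sum>w\<in>G. \<Sum>x\<in>B.
        Re (compose dual w (refl i) \<mu> x * cnj (compose dual w (refl i) \<nu> x)))"
      unfolding form_def
      by (rule sum.reindex_bij_betw[OF bij, symmetric])
    then show ?thesis using \<mu>\<nu> by (simp add: form_def compose_def)
  qed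
  \<comment> \<open>Since \<open>refl i\<close> negates \<open>\<alpha> i\<close>, invariance gives
    \<open>form \<mu> (\<alpha> i) = - form (refl i \<mu>) (\<alpha> i)\<close>; expanding
    \<open>refl i \<mu>\<close> yields the claim.\<close>
  have form_root: "2 * form \<mu> (\<alpha> i) = r * form (\<alpha> i) (\<alpha> i)"
    if i: "i \<in> J" "\<Lambda> (coroot i) = 0" and \<mu>: "\<mu> \<in> dual" "\<mu> (coroot i) = of_real r" for i \<mu> r
  proof -
    have iI: "i \<in> I" using i J by auto
    have "refl i (\<alpha> i) = \<alpha> i - fun_scale (of_real 2) (\<alpha> i)"
      using root_in_dual[OF iI] root_self[OF iI] by (simp add: refl_eq)
    then have "form (refl i \<mu>) (refl i (\<alpha> i)) = - form (refl i \<mu>) (\<alpha> i)"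
      using form_diff[OF root_in_dual[OF iI] root_in_dual[OF iI], of 2 "refl i \<mu>"]
      by (simp add: form_sym)
    moreover have "form (refl i \<mu>) (\<alpha> i) = form \<mu> (\<alpha> i) - r * form (\<alpha> i) (\<alpha> i)"
      using form_diff[OF \<mu>(1) root_in_dual[OF iI]] \<mu> by (simp add: refl_eq)
    ultimately show ?thesis
      using form_refl[OF i \<mu>(1) root_in_dual[OF iI]] by simp
  qed
  define \<beta> where "\<beta> = root_comb (\<lambda>i. of_nat (b i))"
  have \<beta>_dual: "\<beta> \<in> dual" by (simp add: \<beta>_def root_comb_dual)
  have nonpos: "real (b i) * form (\<alpha> i) \<beta> \<le> 0" if iI: "i \<in> I" for i
  proof (cases "b i > 0")
    case True
    have "\<beta> (coroot i) = of_real (real_of_int (\<Sum>j\<in>I. A i j * int (b j)))"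
      by (simp add: \<beta>_def root_comb_coroot[OF iI] mult.commute)
    then have "2 * form \<beta> (\<alpha> i) = real_of_int (\<Sum>j\<in>I. A i j * int (b j)) * form (\<alpha> i) (\<alpha> i)"
      using b[OF iI True] form_root[OF _ _ \<beta>_dual] by blast
    also have "\<dots> \<le> 0"
      using b[OF iI True] form_nonneg[of "\<alpha> i"]
      by (intro mult_nonpos_nonneg) (simp_all only: of_int_le_0_iff)
    finally have "form \<beta> (\<alpha> i) \<le> 0" by simp
    then show ?thesis by (simp add: form_sym[of "\<alpha> i"] mult_nonneg_nonpos)
  qed simp
  let ?s = "\<lambda>S. \<Sum>i\<in>S. fun_scale (of_nat (b i)) (\<alpha> i)"
  \<comment> \<open>Linearity is available only as \<open>form_diff\<close>, on elements of
    \<open>dual\<close>. Hence membership is part of the induction, sums appear as differences with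
    a negative scalar, and \<open>form 0 \<beta> = 0\<close> comes from
    \<open>0 = 0 - 1 * 0\<close>.\<close>
  have expand: "form (?s S) \<beta> = (\<Sum>i\<in>S. real (b i) * form (\<alpha> i) \<beta>)
      \<and> ?s S \<in> dual"
    if "finite S" "S \<subseteq> I" for S
    using that
  proof (induction S)
    case empty
    have z: "(0 :: 'h \<Rightarrow> complex) \<in> dual" by (simp add: dual_iff)
    have "form (0 - fun_scale (of_real 1) 0) \<beta> = form 0 \<beta> - 1 * form 0 \<beta>"
      by (rule form_diff[OF z z])
    moreover have "0 - fun_scale (of_real 1) 0 = (0 :: 'h \<Rightarrow> complex)"
      by (rule ext) simp
    ultimately have "form 0 \<beta> = 0" by simp
    moreover have "?s {} = 0" by (rule sum.empty)
    ultimately show "form (?s {}) \<beta> = (\<Sum>i\<in>{}. real (b i) * form (\<alpha> i) \<beta>) \<and> ?s {} \<in> dual"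
      using z by (simp only: sum.empty)
  next
    case (insert i S)
    have i: "\<alpha> i \<in> dual" using insert root_in_dual by auto
    have s: "?s S \<in> dual" using insert by blast
    have eq: "?s (insert i S) = ?s S - fun_scale (of_real (- real (b i))) (\<alpha> i)"
      by (rule ext) (simp add: sum_fun_apply insert.hyps)
    have step: "form (?s (insert i S)) \<beta> = form (?s S) \<beta> - (- real (b i)) * form (\<alpha> i) \<beta>"
      unfolding eq by (rule form_diff[OF s i])
    have IH: "form (?s S) \<beta> = (\<Sum>i\<in>S. real (b i) * form (\<alpha> i) \<beta>)"
      using insert by blast
    have "form (?s (insert i S)) \<beta> = (\<Sum>i\<in>insert i S. real (b i) * form (\<alpha> i) \<beta>)"
      unfolding step IH using insert.hyps by simp
    moreover have "?s (insert i S) \<in> dual"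
      unfolding eq by (intro dual_diff dual_fun_scale s i)
    ultimately show "form (?s (insert i S)) \<beta> = (\<Sum>i\<in>insert i S. real (b i) * form (\<alpha> i) \<beta>)
        \<and> ?s (insert i S) \<in> dual" by blast
  qed
  \<comment> \<open>Each summand is nonpositive, whereas the total is a square norm:
    \<open>\<beta>\<close> must be 0.\<close>
  have "form \<beta> \<beta> = (\<Sum>i\<in>I. real (b i) * form (\<alpha> i) \<beta>)"
    using expand[OF finite_I subset_refl] by (simp add: \<beta>_def root_comb_def)
  then have "form \<beta> \<beta> \<le> 0" using nonpos by (simp add: sum_nonpos)
  then have "\<beta> = 0" using form_nonneg[of \<beta>] form_0[OF \<beta>_dual] by simp
  then show ?thesis using i by (simp add: \<beta>_def root_comb_eq_0_iff)
qed

end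

section \<open>Modules over a Kac--Moody algebra\<close>

locale kac_moody_module =
  kac_moody_algebra hscale I A \<alpha> coroot gscale bracket hmap e f +
  lie_module gscale bracket mscale act
  for hscale :: "complex \<Rightarrow> 'h::ab_group_add \<Rightarrow> 'h"
    and I :: "'i set"
    and A :: "'i \<Rightarrow> 'i \<Rightarrow> int"
    and \<alpha> :: "'i \<Rightarrow> 'h \<Rightarrow> complex"
    and coroot :: "'i \<Rightarrow> 'h"
    and gscale :: "complex \<Rightarrow> 'g::ab_group_add \<Rightarrow> 'g"
    and bracket :: "'g \<Rightarrow> 'g \<Rightarrow> 'g"
    and hmap :: "'h \<Rightarrow> 'g"
    and e f :: "'i \<Rightarrow> 'g"
    and mscale :: "complex \<Rightarrow> 'm::ab_group_add \<Rightarrow> 'm"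
    and act :: "'g \<Rightarrow> 'm \<Rightarrow> 'm"
begin

lemma act_add_left: "act (x + y) m = act x m + act y m"
  and act_scale_left: "act (gscale c x) m = mscale c (act x m)"
  and act_add_right: "act x (m + n) = act x m + act x n"
  and act_scale_right: "act x (mscale c m) = mscale c (act x m)"
  using act_linear_left[of m] act_linear_right[of x] by (simp_all add: Vector_Spaces.linear_iff)

lemma act_zero_left [simp]: "act 0 m = 0"
  using act_add_left[of 0 0 m] by simp

lemma act_zero_right [simp]: "act x 0 = 0"
  using act_add_right[of x 0 0] by simp

lemma act_uminus_left: "act (- x) m = - act x m"
  using act_add_left[of "- x" x m] by (simp add: eq_neg_iff_add_eq_0)

lemma act_sum_right: "act x (\<Sum>i\<in>S. g i) = (\<Sum>i\<in>S. act x (g i))"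
  by (induction S rule: infinite_finite_induct) (auto simp: act_add_right)

lemma bracket_add_left: "bracket (x + y) z = bracket x z + bracket y z"
  and bracket_add_right: "bracket x (y + z) = bracket x y + bracket x z"
  and bracket_scale_right: "bracket x (gscale c y) = gscale c (bracket x y)"
  using g.bracket_linear_left[of z] g.bracket_linear_right[of x]
  by (simp_all add: Vector_Spaces.linear_iff)

lemma bracket_zero_right [simp]: "bracket x 0 = 0"
  using bracket_add_right[of x 0 0] by simp

lemma bracket_uminus_right: "bracket x (- y) = - bracket x y"
  using bracket_add_right[of x "- y" y] by (simp add: eq_neg_iff_add_eq_0)

lemma bracket_skew: "bracket x y = - bracket y x"
  using g.bracket_alternating[of "x + y"] g.bracket_alternating[of x] g.bracket_alternating[of y]
  by (simp add: bracket_add_left bracket_add_right eq_neg_iff_add_eq_0 add.commute)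

subsection \<open>The defining relations\<close>

abbreviation (input) term_val where
  "term_val \<equiv> lie_eval gscale bracket (case_km_gen hmap e f)"

lemma relation_holds:
  assumes "(s, t) \<in> km_relations hscale I A \<alpha> coroot" "gens s \<subseteq> km_gens I" "gens t \<subseteq> km_gens I"
  shows "term_val s = term_val t"
  using presentation assms lie_cong.relation unfolding lie_presentation_def by blast

lemma h_e: "i \<in> I \<Longrightarrow> bracket (hmap x) (e i) = gscale (\<alpha> i x) (e i)"
  using relation_holds[of "Br (Gen (Hg x)) (Gen (Eg i))" "Scale (\<alpha> i x) (Gen (Eg i))"]
  by (simp add: km_relations_def km_gens_def)

lemma h_f: "i \<in> I \<Longrightarrow> bracket (hmap x) (f i) = gscale (- \<alpha> i x) (f i)"
  using relation_holds[of "Br (Gen (Hg x)) (Gen (Fg i))" "Scale (- \<alpha> i x) (Gen (Fg i))"]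
  by (simp add: km_relations_def km_gens_def)

lemma e_f_same: "i \<in> I \<Longrightarrow> bracket (e i) (f i) = hmap (coroot i)"
  using relation_holds[of "Br (Gen (Eg i)) (Gen (Fg i))" "Gen (Hg (coroot i))"]
  by (simp add: km_relations_def km_gens_def)

lemma e_f_different: "i \<in> I \<Longrightarrow> j \<in> I \<Longrightarrow> i \<noteq> j \<Longrightarrow> bracket (e i) (f j) = 0"
  using relation_holds[of "Br (Gen (Eg i)) (Gen (Fg j))" Zero]
  by (simp add: km_relations_def km_gens_def)

lemma serre_f:
  assumes "i \<in> I" "j \<in> I" "i \<noteq> j"
  shows "(bracket (f i) ^^ nat (1 - A i j)) (f j) = 0"
proof -
  let ?t = "\<lambda>n. (Br (Gen (Fg i)) ^^ n) (Gen (Fg j)) :: ('h, 'i) km_gen lie_term"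
  have val: "term_val (?t n) = (bracket (f i) ^^ n) (f j)" for n
    by (induction n) auto
  have gens: "gens (?t n) \<subseteq> km_gens I" for n
    using assms by (induction n) (auto simp: km_gens_def)
  have "(?t (nat (1 - A i j)), Zero) \<in> km_relations hscale I A \<alpha> coroot"
    unfolding km_relations_def Let_def using assms by blast
  from relation_holds[OF this gens] show ?thesis by (simp add: val)
qed

text \<open>Every element of the algebra is the value of a Lie term in the generators, and a bracket
  acts as a commutator, so induction on terms suffices.\<close>

lemma submodule_generators:
  assumes N: "M.subspace N"
    and h: "\<And>x m. m \<in> N \<Longrightarrow> act (hmap x) m \<in> N"
    and e: "\<And>i m. i \<in> I \<Longrightarrow> m \<in> N \<Longrightarrow> act (e i) m \<in> N"
    and f: "\<And>i m. i \<in> I \<Longrightarrow> m \<in> N \<Longrightarrow> act (f i) m \<in> N"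
  shows "submodule mscale act N"
proof -
  have t: "act (term_val t) m \<in> N" if "gens t \<subseteq> km_gens I" "m \<in> N" for t m
    using that
  proof (induction t arbitrary: m)
    case (Gen y)
    then show ?case using h e f by (auto simp: km_gens_def)
  qed (simp_all add: M.subspace_0[OF N] act_add_left act_scale_left act_bracket M.subspace_add[OF N]
      M.subspace_diff[OF N] M.subspace_scale[OF N])
  have "\<exists>t. gens t \<subseteq> km_gens I \<and> x = term_val t" for x
    using presentation by (auto simp: lie_presentation_def)
  then show ?thesis using N t unfolding submodule_def by metis
qed

subsection \<open>Weight vectors\<close>

abbreviation wspace :: "('h \<Rightarrow> complex) \<Rightarrow> 'm set" where
  "wspace \<equiv> weight_space mscale (\<lambda>x. act (hmap x))"

lemma wspace_iff: "m \<in> wspace \<mu> \<longleftrightarrow> (\<forall>x. act (hmap x) m = mscale (\<mu> x) m)"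
  by (simp add: weight_space_def)

lemma wspace_0 [simp]: "0 \<in> wspace \<mu>"
  by (simp add: wspace_iff)

lemma wspace_add: "m \<in> wspace \<mu> \<Longrightarrow> n \<in> wspace \<mu> \<Longrightarrow> m + n \<in> wspace \<mu>"
  by (simp add: wspace_iff act_add_right M.scale_right_distrib)

lemma wspace_scale: "m \<in> wspace \<mu> \<Longrightarrow> mscale c m \<in> wspace \<mu>"
  by (simp add: wspace_iff act_scale_right mult.commute)

lemma act_e_wspace:
  assumes "i \<in> I" "m \<in> wspace \<mu>"
  shows "act (e i) m \<in> wspace (\<mu> + \<alpha> i)"
  unfolding wspace_iff
proof
  fix x
  have "act (hmap x) (act (e i) m) = act (bracket (hmap x) (e i)) m + act (e i) (act (hmap x) m)"
    by (simp add: act_bracket)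
  then show "act (hmap x) (act (e i) m) = mscale ((\<mu> + \<alpha> i) x) (act (e i) m)"
    using assms by (simp add: h_e act_scale_left wspace_iff act_scale_right M.scale_left_distrib)
qed

lemma act_f_wspace:
  assumes "i \<in> I" "m \<in> wspace \<mu>"
  shows "act (f i) m \<in> wspace (\<mu> - \<alpha> i)"
  unfolding wspace_iff
proof
  fix x
  have "act (hmap x) (act (f i) m) = act (bracket (hmap x) (f i)) m + act (f i) (act (hmap x) m)"
    by (simp add: act_bracket)
  then show "act (hmap x) (act (f i) m) = mscale ((\<mu> - \<alpha> i) x) (act (f i) m)"
    using assms
    by (simp add: h_f act_uminus_left act_scale_left wspace_iff act_scale_right
        M.scale_left_diff_distrib)
qed

lemma act_e_power_wspace:
  assumes "i \<in> I" "m \<in> wspace \<mu>"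
  shows "(act (e i) ^^ k) m \<in> wspace (\<mu> + fun_scale (of_nat k) (\<alpha> i))"
proof (induction k)
  case 0
  have "\<mu> + fun_scale (of_nat 0) (\<alpha> i) = \<mu>" by (rule ext) simp
  then show "(act (e i) ^^ 0) m \<in> wspace (\<mu> + fun_scale (of_nat 0) (\<alpha> i))"
    using assms by (simp only: funpow_0)
next
  case (Suc k)
  have "\<mu> + fun_scale (of_nat k) (\<alpha> i) + \<alpha> i = \<mu> + fun_scale (of_nat (Suc k)) (\<alpha> i)"
    by (rule ext) (simp add: algebra_simps)
  then show "(act (e i) ^^ Suc k) m \<in> wspace (\<mu> + fun_scale (of_nat (Suc k)) (\<alpha> i))"
    using act_e_wspace[OF assms(1) Suc] by (simp only: funpow.simps comp_apply)
qed

lemma act_f_power_wspace: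
  assumes "i \<in> I" "m \<in> wspace \<mu>"
  shows "(act (f i) ^^ k) m \<in> wspace (\<mu> - fun_scale (of_nat k) (\<alpha> i))"
proof (induction k)
  case 0
  have "\<mu> - fun_scale (of_nat 0) (\<alpha> i) = \<mu>" by (rule ext) simp
  then show "(act (f i) ^^ 0) m \<in> wspace (\<mu> - fun_scale (of_nat 0) (\<alpha> i))"
    using assms by (simp only: funpow_0)
next
  case (Suc k)
  have "\<mu> - fun_scale (of_nat k) (\<alpha> i) - \<alpha> i = \<mu> - fun_scale (of_nat (Suc k)) (\<alpha> i)"
    by (rule ext) (simp add: algebra_simps)
  then show "(act (f i) ^^ Suc k) m \<in> wspace (\<mu> - fun_scale (of_nat (Suc k)) (\<alpha> i))"
    using act_f_wspace[OF assms(1) Suc] by (simp only: funpow.simps comp_apply)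
qed

section \<open>Independence and spans of weight vectors\<close>

text \<open>Applying \<open>hmap x\<close> and subtracting \<open>\<mu> x\<close> times the sum
  removes the component of weight \<open>\<mu>\<close> and rescales the others. To treat
  \<open>\<nu>\<close>, choose \<open>x\<close> with
  \<open>\<nu> x \<noteq> \<mu> x\<close>.\<close>

lemma weight_vectors_independent:
  assumes "finite S" "\<And>\<nu>. \<nu> \<in> S \<Longrightarrow> g \<nu> \<in> wspace \<nu>" "(\<Sum>\<nu>\<in>S. g \<nu>) = 0" "\<nu> \<in> S"
  shows "g \<nu> = 0"
  using assms
proof (induction S arbitrary: g \<nu>)
  case (insert \<mu> S)
  have eig: "act (hmap x) (g \<nu>) = mscale (\<nu> x) (g \<nu>)" if "\<nu> \<in> insert \<mu> S" for x \<nu>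
    using insert.prems(1)[OF that] by (simp add: wspace_iff)
  have S: "g \<nu> = 0" if \<nu>: "\<nu> \<in> S" for \<nu>
  proof -
    have "\<nu> \<noteq> \<mu>" using insert.hyps \<nu> by auto
    then obtain x where x: "\<nu> x \<noteq> \<mu> x" by auto
    have "0 = act (hmap x) (\<Sum>\<nu>\<in>insert \<mu> S. g \<nu>) - mscale (\<mu> x) (\<Sum>\<nu>\<in>insert \<mu> S. g \<nu>)"
      using insert.prems(2) by simp
    also have "\<dots> = (\<Sum>\<nu>\<in>insert \<mu> S. mscale (\<nu> x) (g \<nu>) - mscale (\<mu> x) (g \<nu>))"
      by (simp only: act_sum_right M.scale_sum_right sum_subtractf eig cong: sum.cong)
    also have "\<dots> = (\<Sum>\<nu>\<in>S. mscale (\<nu> x - \<mu> x) (g \<nu>))"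
      using insert.hyps by (simp add: M.scale_left_diff_distrib)
    finally have "mscale (\<nu> x - \<mu> x) (g \<nu>) = 0"
      using insert.IH[of "\<lambda>\<nu>. mscale (\<nu> x - \<mu> x) (g \<nu>)" \<nu>] insert.prems(1) \<nu>
      by (simp add: wspace_scale)
    then show ?thesis using x by simp
  qed
  then have "g \<mu> = 0" using insert.prems(2) insert.hyps by simp
  then show ?case using S insert.prems(3) by auto
qed simp

lemma span_weight_vectors:
  assumes T: "T \<subseteq> (\<Union>\<nu>\<in>P. wspace \<nu>)" and m: "m \<in> M.span T" "m \<in> wspace \<mu>" "m \<noteq> 0"
  shows "\<mu> \<in> P"
proof (rule ccontr)
  assume \<mu>: "\<mu> \<notin> P"
  have "\<exists>S g. finite S \<and> S \<subseteq> P \<and> (\<forall>\<nu>\<in>S. g \<nu> \<in> wspace \<nu>) \<and> m = (\<Sum>\<nu>\<in>S. g \<nu>)"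
    using m(1)
  proof (induction rule: M.span_induct_alt)
    case base
    show ?case by (rule exI[of _ "{}"]) simp
  next
    case (step c x y)
    then obtain S g where S: "finite S" "S \<subseteq> P" "\<forall>\<nu>\<in>S. g \<nu> \<in> wspace \<nu>" "y = (\<Sum>\<nu>\<in>S. g \<nu>)"
      by blast
    obtain \<nu> where \<nu>: "\<nu> \<in> P" "x \<in> wspace \<nu>" using step T by blast
    \<comment> \<open>If the weight \<open>\<nu>\<close> of the new vector already occurs, the two
      components are merged, so that each weight keeps a single component.\<close>
    define g' where "g' = g(\<nu> := mscale c x + (if \<nu> \<in> S then g \<nu> else 0))"
    have "mscale c x + y = (\<Sum>\<nu>\<in>insert \<nu> S. g' \<nu>)"
    proof (cases "\<nu> \<in> S")
      case True
      then have "(\<Sum>\<nu>\<in>S. g \<nu>) = g \<nu> + (\<Sum>\<nu>\<in>S - {\<nu>}. g \<nu>)"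
        and "(\<Sum>\<nu>\<in>S. g' \<nu>) = g' \<nu> + (\<Sum>\<nu>\<in>S - {\<nu>}. g' \<nu>)"
        using S(1) by (simp_all add: sum.remove)
      moreover have "(\<Sum>\<nu>\<in>S - {\<nu>}. g' \<nu>) = (\<Sum>\<nu>\<in>S - {\<nu>}. g \<nu>)"
        by (rule sum.cong) (auto simp: g'_def)
      ultimately show ?thesis
        using True S(4) by (simp add: insert_absorb g'_def add.assoc)
    next
      case False
      moreover from False have "(\<Sum>\<nu>\<in>S. g' \<nu>) = (\<Sum>\<nu>\<in>S. g \<nu>)"
        by (intro sum.cong) (auto simp: g'_def)
      ultimately show ?thesis using S by (simp add: g'_def)
    qed
    moreover have "\<forall>\<xi>\<in>insert \<nu> S. g' \<xi> \<in> wspace \<xi>"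
      using S(3) \<nu> by (auto simp: g'_def wspace_add wspace_scale)
    ultimately show ?case
      using S \<nu> by (intro exI[of _ "insert \<nu> S"] exI[of _ g']) simp
  qed
  then obtain S g where S: "finite S" "S \<subseteq> P" "\<forall>\<nu>\<in>S. g \<nu> \<in> wspace \<nu>" "m = (\<Sum>\<nu>\<in>S. g \<nu>)"
    by blast
  have \<mu>S: "\<mu> \<notin> S" using \<mu> S by auto
  \<comment> \<open>With \<open>- m\<close> as component of the new weight \<open>\<mu>\<close> the
    sum becomes 0, and independence forces \<open>m = 0\<close>.\<close>
  define g' where "g' = g(\<mu> := mscale (- 1) m)"
  have "(\<Sum>\<nu>\<in>S. g' \<nu>) = m"
    unfolding S(4) by (rule sum.cong) (use \<mu>S in \<open>auto simp: g'_def\<close>)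
  then have "(\<Sum>\<nu>\<in>insert \<mu> S. g' \<nu>) = 0"
    using S(1) \<mu>S by (simp add: g'_def)
  then have "g' \<mu> = 0"
    by (rule weight_vectors_independent[rotated 2]) (use S \<mu>S m(2) in \<open>auto simp: g'_def wspace_scale simp del: M.scale_minus_left\<close>)
  then show False using m(3) by (simp add: g'_def)
qed

text \<open>The words in the \<open>f i\<close> applied to \<open>u\<close> span a submodule, which
  is everything by simplicity. The vector \<open>u\<close> is arbitrary because the lemma serves
  twice: for the highest weight vector, and for a hypothetical singular vector further down, whose
  existence it refutes.\<close>

lemma singular_vector_bounds_weights:
  assumes simple: "simple_module mscale act"
    and u: "u \<noteq> 0" "u \<in> wspace \<mu>" "\<And>i. i \<in> I \<Longrightarrow> act (e i) u = 0"
    and m: "m \<noteq> 0" "m \<in> wspace \<nu>"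
  shows "weight_le I \<alpha> \<nu> \<mu>"
proof -
  define T where "T = {foldr (\<lambda>i. act (f i)) is u | is. set is \<subseteq> I}"
  define P where "P = {\<nu>. weight_le I \<alpha> \<nu> \<mu>}"
  have word: "\<exists>\<nu>\<in>P. foldr (\<lambda>i. act (f i)) is u \<in> wspace \<nu>" if "set is \<subseteq> I" for "is"
    using that
  proof (induction "is")
    case Nil
    have "weight_le I \<alpha> \<mu> \<mu>"
      unfolding weight_le_iff by (rule exI[of _ "\<lambda>_. 0"]) (simp add: root_comb_apply fun_eq_iff)
    then show ?case using u by (auto simp: P_def)
  next
    case (Cons i "is")
    then obtain n where "foldr (\<lambda>i. act (f i)) is u \<in> wspace (\<mu> - root_comb (\<lambda>i. of_nat (n i)))"
      by (auto simp: P_def weight_le_iff)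
    then have "foldr (\<lambda>i. act (f i)) (i # is) u \<in> wspace (\<mu> - root_comb (\<lambda>i. of_nat (n i)) - \<alpha> i)"
      using Cons.prems act_f_wspace by simp
    moreover have "root_comb (\<lambda>j. of_nat (n j) + (if j = i then 1 else 0)) =
        root_comb (\<lambda>i. of_nat (n i)) + \<alpha> i"
      using Cons.prems root_comb_single[of i 1] by (simp add: root_comb_add fun_eq_iff)
    then have "\<mu> - root_comb (\<lambda>i. of_nat (n i)) - \<alpha> i =
        \<mu> - root_comb (\<lambda>j. of_nat (n j + (if j = i then 1 else 0)))"
      by (simp add: diff_diff_eq if_distrib[of of_nat] cong: if_cong)
    then have "weight_le I \<alpha> (\<mu> - root_comb (\<lambda>i. of_nat (n i)) - \<alpha> i) \<mu>"
      unfolding weight_le_iff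
      by (intro exI[of _ "\<lambda>j. n j + (if j = i then 1 else 0)"])
    ultimately show ?case unfolding P_def by blast
  qed
  then have TP: "T \<subseteq> (\<Union>\<nu>\<in>P. wspace \<nu>)" by (auto simp: T_def)
  have span_closed: "act x m \<in> M.span T" if "\<And>t. t \<in> T \<Longrightarrow> act x t \<in> M.span T" "m \<in> M.span T" for x m
    using that(2)
    by (induction rule: M.span_induct_alt)
      (auto simp: act_add_right act_scale_right that(1) intro!: M.span_add M.span_scale M.span_zero)
  have h: "act (hmap x) m \<in> M.span T" if "m \<in> M.span T" for x m
  proof (rule span_closed[OF _ that])
    fix t assume t: "t \<in> T"
    then obtain \<nu> where "t \<in> wspace \<nu>" using TP by blast
    then show "act (hmap x) t \<in> M.span T"
      using t by (simp add: wspace_iff M.span_scale M.span_base)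
  qed
  have f: "act (f i) m \<in> M.span T" if "i \<in> I" "m \<in> M.span T" for i m
  proof (rule span_closed[OF _ that(2)])
    fix t assume "t \<in> T"
    then obtain "is" where is_def: "t = foldr (\<lambda>i. act (f i)) is u" "set is \<subseteq> I"
      by (auto simp: T_def)
    then have "act (f i) t \<in> T"
      unfolding T_def using that(1) by (intro CollectI exI[of _ "i # is"]) simp
    then show "act (f i) t \<in> M.span T" by (rule M.span_base)
  qed
  \<comment> \<open>Moving \<open>e i\<close> past the first letter \<open>f j\<close> leaves at
    most a coroot acting on the shorter word, which only scales it.\<close>
  have ef_word: "act (e i) (foldr (\<lambda>i. act (f i)) is u) \<in> M.span T"
    if "i \<in> I" "set is \<subseteq> I" for i "is"
    using that(2)
  proof (induction "is")
    case Nil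
    show ?case using u(3)[OF that(1)] by (simp add: M.span_zero)
  next
    case (Cons j "is")
    let ?w = "foldr (\<lambda>i. act (f i)) is u"
    have w: "?w \<in> M.span T" using Cons.prems by (intro M.span_base) (auto simp: T_def)
    have "act (bracket (e i) (f j)) ?w \<in> M.span T"
      using e_f_same e_f_different that(1) Cons.prems h[OF w]
      by (cases "i = j") (auto simp: M.span_zero)
    moreover have "act (f j) (act (e i) ?w) \<in> M.span T" using Cons f by auto
    moreover have "act (e i) (act (f j) ?w) = act (bracket (e i) (f j)) ?w + act (f j) (act (e i) ?w)"
      by (simp add: act_bracket)
    ultimately show ?case by (simp add: M.span_add)
  qed
  have e: "act (e i) m \<in> M.span T" if "i \<in> I" "m \<in> M.span T" for i m
    by (rule span_closed[OF _ that(2)]) (use ef_word[OF that(1)] in \<open>auto simp: T_def\<close>)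
  have "submodule mscale act (M.span T)"
    by (rule submodule_generators) (auto intro: h e f)
  moreover have "u \<in> M.span T"
    by (rule M.span_base) (auto simp: T_def intro!: exI[of _ "[]"])
  ultimately have "M.span T = UNIV"
    using simple u(1) unfolding simple_module_def by blast
  then show ?thesis
    using span_weight_vectors[OF TP _ m(2,1)] by (simp add: P_def)
qed

subsection \<open>Strings\<close>

text \<open>The triple is abstract because it is used as \<open>e i\<close>, \<open>f i\<close>,
  \<open>hmap (coroot i)\<close> and, for strings running upwards, as \<open>f i\<close>,
  \<open>e i\<close>, \<open>- hmap (coroot i)\<close>.\<close>

lemma sl2_string:
  assumes xy: "bracket x y = h" and hy: "bracket h y = gscale (- 2) y"
    and w: "act x w = 0" "act h w = mscale c w"
  shows "act h ((act y ^^ k) w) = mscale (c - 2 * of_nat k) ((act y ^^ k) w)"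
    and "act x ((act y ^^ Suc k) w) = mscale (of_nat (Suc k) * (c - of_nat k)) ((act y ^^ k) w)"
proof -
  have hk: "act h ((act y ^^ k) w) = mscale (c - 2 * of_nat k) ((act y ^^ k) w)" for k
  proof (induction k)
    case (Suc k)
    have "act h (act y ((act y ^^ k) w)) = act (bracket h y) ((act y ^^ k) w) + act y (act h ((act y ^^ k) w))"
      by (simp add: act_bracket)
    also have "\<dots> = mscale (- 2 + (c - 2 * of_nat k)) (act y ((act y ^^ k) w))"
      unfolding Suc hy act_scale_left act_scale_right M.scale_left_distrib ..
    finally show ?case by (simp add: algebra_simps)
  qed (simp add: w)
  then show "act h ((act y ^^ k) w) = mscale (c - 2 * of_nat k) ((act y ^^ k) w)" .
  have step: "act x (act y m) = act h m + act y (act x m)" for m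
    using act_bracket[of x y m] by (simp add: xy)
  show "act x ((act y ^^ Suc k) w) = mscale (of_nat (Suc k) * (c - of_nat k)) ((act y ^^ k) w)"
  proof (induction k)
    case 0
    then show ?case using step[of w] w by simp
  next
    case (Suc k)
    have "act x ((act y ^^ Suc (Suc k)) w) = act h ((act y ^^ Suc k) w) + act y (act x ((act y ^^ Suc k) w))"
      using step by simp
    also have "\<dots> = mscale (c - 2 * of_nat (Suc k) + of_nat (Suc k) * (c - of_nat k)) ((act y ^^ Suc k) w)"
      unfolding hk Suc act_scale_right by (simp add: M.scale_left_distrib)
    also have "c - 2 * of_nat (Suc k) + of_nat (Suc k) * (c - of_nat k) =
        of_nat (Suc (Suc k)) * (c - of_nat (Suc k))"
      by (simp add: algebra_simps)
    finally show ?case .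
  qed
qed

text \<open>The factors \<open>(k + 1) * (n - k)\<close> of the string do not vanish for
  \<open>k < n\<close>, so \<open>x\<close> can undo each step.\<close>

lemma sl2_nonzero:
  assumes "bracket x y = h" "bracket h y = gscale (- 2) y"
    and "act x w = 0" "act h w = mscale (of_nat n) w" "w \<noteq> 0" "k \<le> n"
  shows "(act y ^^ k) w \<noteq> 0"
  using assms(6)
proof (induction k)
  case (Suc k)
  then have "mscale (of_nat (Suc k) * (of_nat n - of_nat k)) ((act y ^^ k) w) \<noteq> 0"
    by (simp del: of_nat_Suc)
  then have "act x ((act y ^^ Suc k) w) \<noteq> 0"
    using sl2_string(2)[OF assms(1-4), of k] by metis
  then show ?case by (metis act_zero_right)
qed (use assms in simp)

text \<open>At the first vanishing power \<open>l + 1\<close> the factor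
  \<open>(l + 1) * (c - l)\<close> has to vanish, which identifies \<open>c\<close> with
  \<open>l\<close>.\<close>

lemma sl2_nilpotent:
  assumes "bracket x y = h" "bracket h y = gscale (- 2) y"
    and "act x w = 0" "act h w = mscale c w" "w \<noteq> 0" "(act y ^^ n) w = 0"
  shows "c \<in> \<nat>"
proof -
  define k where "k = (LEAST k. (act y ^^ k) w = 0)"
  have k: "(act y ^^ k) w = 0" unfolding k_def using assms(6) by (rule LeastI)
  then obtain l where l: "k = Suc l" using assms(5) by (cases k) auto
  then have "(act y ^^ l) w \<noteq> 0" using not_less_Least[of l "\<lambda>k. (act y ^^ k) w = 0"] by (simp add: k_def)
  moreover have "mscale (of_nat (Suc l) * (c - of_nat l)) ((act y ^^ l) w) = 0"
    using sl2_string(2)[OF assms(1-4), of l] k l by simp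
  ultimately have "c = of_nat l" by (simp del: of_nat_Suc)
  then show ?thesis by simp
qed

lemma sl2_ef:
  assumes "i \<in> I"
  shows "bracket (e i) (f i) = hmap (coroot i)"
    and "bracket (hmap (coroot i)) (f i) = gscale (- 2) (f i)"
    and "bracket (f i) (e i) = - hmap (coroot i)"
    and "bracket (- hmap (coroot i)) (e i) = gscale (- 2) (e i)"
proof -
  show "bracket (e i) (f i) = hmap (coroot i)" "bracket (hmap (coroot i)) (f i) = gscale (- 2) (f i)"
    using assms by (simp_all add: e_f_same h_f root_self)
  show "bracket (f i) (e i) = - hmap (coroot i)"
    using assms e_f_same bracket_skew by metis
  have "bracket (- hmap (coroot i)) (e i) = - bracket (hmap (coroot i)) (e i)"
    using bracket_skew[of "- hmap (coroot i)"] bracket_skew[of "hmap (coroot i)"]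
    by (simp add: bracket_uminus_right)
  then show "bracket (- hmap (coroot i)) (e i) = gscale (- 2) (e i)"
    using assms by (simp add: h_e root_self)
qed

section \<open>Vectors on which \<open>f i\<close> is nilpotent\<close>

text \<open>This replaces the Leibniz expansion of \<open>y\<close> powers: in
  \<open>y (x m) = [y, x] m + x (y m)\<close> the first term lowers \<open>k\<close> and the second
  lowers \<open>n\<close>.\<close>

lemma act_f_nilpotent_closed:
  assumes "(bracket y ^^ k) x = 0" "(act y ^^ n) m = 0"
  shows "\<exists>l. (act y ^^ l) (act x m) = 0"
  using assms
proof (induction "k + n" arbitrary: k n x m rule: less_induct)
  case less
  show ?case
  proof (cases "k = 0 \<or> n = 0")
    case True
    then show ?thesis using less.prems by (intro exI[of _ 0]) auto
  next
    case False
    then obtain k' n' where kn: "k = Suc k'" "n = Suc n'" by (metis not0_implies_Suc)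
    have "(bracket y ^^ k') (bracket y x) = 0" "(act y ^^ n') (act y m) = 0"
      using less.prems by (simp_all add: kn funpow_swap1)
    then obtain l l' where l: "(act y ^^ l) (act (bracket y x) m) = 0"
      and l': "(act y ^^ l') (act x (act y m)) = 0"
      using less.hyps[of k' n "bracket y x" m] less.hyps[of k n' x "act y m"] less.prems kn by auto
    have zero: "(act y ^^ j) 0 = 0" for j by (induction j) auto
    have add: "(act y ^^ j) (p + q) = (act y ^^ j) p + (act y ^^ j) q" for j p q
      by (induction j) (auto simp: act_add_right)
    have "(act y ^^ (l + l')) (act (bracket y x) m) = 0"
      by (metis add.commute funpow_add comp_apply l zero)
    moreover have "(act y ^^ (l + l')) (act x (act y m)) = 0"
      by (metis funpow_add comp_apply l' zero)
    moreover have "act y (act x m) = act (bracket y x) m + act x (act y m)"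
      by (simp add: act_bracket)
    ultimately have "(act y ^^ (l + l')) (act y (act x m)) = 0"
      by (simp add: add)
    then have "(act y ^^ Suc (l + l')) (act x m) = 0"
      by (simp add: funpow_swap1)
    then show ?thesis by blast
  qed
qed

text \<open>The derivation \<open>bracket (f i)\<close> is nilpotent on every generator: exponent 2
  on the image of \<open>hmap\<close>, 3 on \<open>e i\<close>, 1 on \<open>f i\<close> and on the
  other \<open>e j\<close>, and the Serre exponent on the other \<open>f j\<close>.\<close>

lemma f_locally_nilpotent_submodule:
  assumes i: "i \<in> I"
  shows "submodule mscale act {m. \<exists>n. (act (f i) ^^ n) m = 0}" (is "submodule _ _ ?N")
proof (rule submodule_generators)
  have zero: "(act (f i) ^^ j) 0 = 0" for j by (induction j) auto
  have add: "(act (f i) ^^ j) (p + q) = (act (f i) ^^ j) p + (act (f i) ^^ j) q" for j p q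
    by (induction j) (auto simp: act_add_right)
  have scale: "(act (f i) ^^ j) (mscale c p) = mscale c ((act (f i) ^^ j) p)" for j p c
    by (induction j) (auto simp: act_scale_right)
  show "M.subspace ?N"
  proof (rule M.subspaceI)
    show "0 \<in> ?N" using zero by auto
    show "p + q \<in> ?N" if pq: "p \<in> ?N" "q \<in> ?N" for p q
    proof -
      obtain k l where k: "(act (f i) ^^ k) p = 0" and l: "(act (f i) ^^ l) q = 0"
        using pq by blast
      have "(act (f i) ^^ (k + l)) p = 0"
        by (metis add.commute funpow_add comp_apply k zero)
      moreover have "(act (f i) ^^ (k + l)) q = 0"
        by (metis funpow_add comp_apply l zero)
      ultimately have "(act (f i) ^^ (k + l)) (p + q) = 0" by (simp add: add)
      then show ?thesis by blast
    qed
    show "mscale c p \<in> ?N" if "p \<in> ?N" for c p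
      using that scale by auto
  qed
  have fh: "bracket (f i) (hmap x) = gscale (\<alpha> i x) (f i)" for x
    using bracket_skew[of "f i" "hmap x"] h_f[OF i] by simp
  show "act (hmap x) m \<in> ?N" if "m \<in> ?N" for x m
  proof -
    have "(bracket (f i) ^^ 2) (hmap x) = 0"
      by (simp add: numeral_2_eq_2 fh bracket_scale_right g.bracket_alternating)
    then show ?thesis using that act_f_nilpotent_closed by blast
  qed
  show "act (e j) m \<in> ?N" if "j \<in> I" "m \<in> ?N" for j m
  proof (cases "j = i")
    case True
    have "(bracket (f i) ^^ 3) (e j) = 0"
      unfolding True
      by (simp add: numeral_3_eq_3 sl2_ef(3)[OF i] fh bracket_scale_right bracket_uminus_right
          g.bracket_alternating)
    then show ?thesis using that act_f_nilpotent_closed by blast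
  next
    case False
    have "(bracket (f i) ^^ 1) (e j) = 0"
      using bracket_skew[of "f i" "e j"] e_f_different[OF that(1) i False] by simp
    then show ?thesis using that act_f_nilpotent_closed by blast
  qed
  show "act (f j) m \<in> ?N" if "j \<in> I" "m \<in> ?N" for j m
  proof (cases "j = i")
    case True
    have "(bracket (f i) ^^ 1) (f j) = 0"
      by (simp add: True g.bracket_alternating)
    then show ?thesis using that act_f_nilpotent_closed by blast
  next
    case False
    then show ?thesis using that act_f_nilpotent_closed serre_f[OF i that(1)] by blast
  qed
qed

end

subsection \<open>Simple highest weight modules\<close>

locale simple_highest_weight_module = kac_moody_module +
  fixes \<Lambda> :: "'a \<Rightarrow> complex" and v :: 'd
  assumes \<Lambda>_dual: "\<Lambda> \<in> dual"
    and simple: "simple_module mscale act"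
    and v_nonzero: "v \<noteq> 0"
    and v_weight: "v \<in> wspace \<Lambda>"
    and e_v: "\<And>i. i \<in> I \<Longrightarrow> act (e i) v = 0"
begin

abbreviation J where
  "J \<equiv> integrable_indices I coroot \<Lambda>"

abbreviation wts where
  "wts \<equiv> weights hscale mscale (\<lambda>x. act (hmap x))"

lemma J_subset: "J \<subseteq> I"
  by (auto simp: integrable_indices_def)

lemma weight_le_highest:
  assumes "m \<in> wspace \<nu>" "m \<noteq> 0"
  obtains n where "\<nu> = \<Lambda> - root_comb (\<lambda>i. of_nat (n i))"
  using singular_vector_bounds_weights[OF simple v_nonzero v_weight e_v assms(2,1)] weight_le_iff
  by blast

lemma wts_iff: "\<nu> \<in> wts \<longleftrightarrow> (\<exists>m\<in>wspace \<nu>. m \<noteq> 0)"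
proof
  assume "\<exists>m\<in>wspace \<nu>. m \<noteq> 0"
  then obtain m where m: "m \<in> wspace \<nu>" "m \<noteq> 0" by blast
  obtain n where "\<nu> = \<Lambda> - root_comb (\<lambda>i. of_nat (n i))"
    using weight_le_highest[OF m] by blast
  then have "\<nu> \<in> dual" by (simp only: dual_diff \<Lambda>_dual root_comb_dual)
  then show "\<nu> \<in> wts" using m unfolding weights_def by blast
next
  assume "\<nu> \<in> wts"
  then have "wspace \<nu> \<noteq> {0}" by (simp add: weights_def)
  then show "\<exists>m\<in>wspace \<nu>. m \<noteq> 0" using wspace_0 by blast
qed

lemma coroot_value:
  assumes "i \<in> I" "\<nu> = \<Lambda> - root_comb (\<lambda>j. of_nat (n j))"
  shows "\<nu> (coroot i) = \<Lambda> (coroot i) - of_int (\<Sum>j\<in>I. A i j * int (n j))"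
  using assms by (simp add: root_comb_coroot mult.commute)

section \<open>Local nilpotency and injectivity on the simple module\<close>

lemma e_locally_nilpotent:
  assumes i: "i \<in> I" and m: "m \<in> wspace \<mu>"
  shows "\<exists>n. (act (e i) ^^ n) m = 0"
proof (rule ccontr)
  assume "\<nexists>n. (act (e i) ^^ n) m = 0"
  then have nz: "(act (e i) ^^ n) m \<noteq> 0" for n by blast
  obtain n where n: "\<mu> = \<Lambda> - root_comb (\<lambda>i. of_nat (n i))"
    using weight_le_highest[OF m] nz[of 0] by auto
  \<comment> \<open>One more than the coefficient of \<open>\<alpha> i\<close> in
    \<open>\<Lambda> - \<mu>\<close>: raising \<open>k\<close> times would leave the cone below
    \<open>\<Lambda>\<close>.\<close>
  define k where "k = Suc (n i)"
  obtain n' where n': "\<mu> + fun_scale (of_nat k) (\<alpha> i) = \<Lambda> - root_comb (\<lambda>i. of_nat (n' i))"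
    using weight_le_highest[OF act_e_power_wspace[OF i m, of k] nz] by blast
  have "root_comb (\<lambda>j. of_nat (n j) - (if j = i then of_nat k else 0)) =
      root_comb (\<lambda>j. of_nat (n j)) - fun_scale (of_nat k) (\<alpha> i)"
    by (simp only: root_comb_diff root_comb_single[OF i])
  also have "\<dots> = root_comb (\<lambda>j. of_nat (n' j))"
    using n' unfolding n by (simp only: fun_eq_iff plus_fun_apply minus_apply) (simp add: algebra_simps)
  finally have "of_nat (n i) - of_nat k = (of_nat (n' i) :: complex)"
    using i by (simp only: root_comb_eq_iff) (metis (full_types))
  then have "of_nat (n i) = (of_nat (n' i + k) :: complex)"
    by (simp add: algebra_simps)
  then have "n i = n' i + k" by (simp only: of_nat_eq_iff)
  then show False by (simp add: k_def)
qed

text \<open>With \<open>n = \<Lambda> (coroot i)\<close> the vector \<open>f i ^ (n + 1) v\<close>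
  is singular, because the string factor \<open>n - n\<close> is 0 and the other \<open>e j\<close>
  commute with \<open>f i\<close>. Were it nonzero, it would bound \<open>\<Lambda>\<close> by
  \<open>\<Lambda> - (n + 1) \<alpha> i\<close>. So \<open>v\<close> lies in the submodule of
  vectors on which \<open>f i\<close> is nilpotent.\<close>

lemma f_locally_nilpotent:
  assumes i: "i \<in> J"
  shows "\<exists>n. (act (f i) ^^ n) m = 0"
proof -
  have iI: "i \<in> I" using i J_subset by auto
  obtain n where n: "\<Lambda> (coroot i) = of_nat n"
    using i by (auto simp: integrable_indices_def Nats_def)
  let ?w = "(act (f i) ^^ Suc n) v"
  have hv: "act (hmap (coroot i)) v = mscale (of_nat n) v"
    using v_weight by (simp add: wspace_iff n)
  have "?w = 0"
  proof (rule ccontr)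
    assume w: "?w \<noteq> 0"
    have "act (e i) ?w = 0"
      using sl2_string(2)[OF sl2_ef(1,2)[OF iI] e_v[OF iI] hv, of n] by simp
    moreover have "act (e j) ((act (f i) ^^ k) v) = 0" if j: "j \<in> I" "j \<noteq> i" for j k
    proof (induction k)
      case (Suc k)
      have "act (e j) (act (f i) ((act (f i) ^^ k) v)) =
          act (bracket (e j) (f i)) ((act (f i) ^^ k) v) + act (f i) (act (e j) ((act (f i) ^^ k) v))"
        by (simp add: act_bracket)
      then show ?case using Suc e_f_different[OF j(1) iI j(2)] by simp
    qed (use e_v j in simp)
    ultimately have "act (e j) ?w = 0" if "j \<in> I" for j
      using that by blast
    from singular_vector_bounds_weights[OF simple w act_f_power_wspace[OF iI v_weight] this
        v_nonzero v_weight]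
    obtain k where "\<Lambda> = \<Lambda> - fun_scale (of_nat (Suc n)) (\<alpha> i) - root_comb (\<lambda>j. of_nat (k j))"
      unfolding weight_le_iff by blast
    then have "fun_scale (of_nat (Suc n)) (\<alpha> i) + root_comb (\<lambda>j. of_nat (k j)) = 0"
      by (simp only: fun_eq_iff plus_fun_apply minus_apply zero_fun_apply) (simp add: algebra_simps)
    then have "root_comb (\<lambda>j. (if j = i then of_nat (Suc n) else 0) + of_nat (k j)) = 0"
      by (simp only: root_comb_add root_comb_single[OF iI])
    then have "of_nat (Suc n) + of_nat (k i) = (0 :: complex)"
      using iI by (simp only: root_comb_eq_0_iff) (metis (full_types))
    then show False by (metis Suc_neq_Zero add_is_0 of_nat_add of_nat_eq_0_iff)
  qed
  then have "v \<in> {m. \<exists>n. (act (f i) ^^ n) m = 0}" by blast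
  then show ?thesis
    using simple f_locally_nilpotent_submodule[OF iI] v_nonzero unfolding simple_module_def by blast
qed

text \<open>Nilpotency on \<open>v\<close> would force \<open>\<Lambda> (coroot i)\<close> to be a
  natural number; the submodule is therefore proper, hence 0.\<close>

lemma f_injective:
  assumes i: "i \<in> I" "i \<notin> J" and m: "act (f i) m = 0"
  shows "m = 0"
proof -
  let ?N = "{m. \<exists>n. (act (f i) ^^ n) m = 0}"
  have "v \<notin> ?N"
  proof
    assume "v \<in> ?N"
    then obtain n where n: "(act (f i) ^^ n) v = 0" by blast
    have "act (hmap (coroot i)) v = mscale (\<Lambda> (coroot i)) v"
      using v_weight by (simp add: wspace_iff)
    from sl2_nilpotent[OF sl2_ef(1,2)[OF i(1)] e_v[OF i(1)] this v_nonzero n]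
    show False using i by (simp add: integrable_indices_def)
  qed
  moreover have "?N = {0} \<or> ?N = UNIV"
    using simple f_locally_nilpotent_submodule[OF i(1)] unfolding simple_module_def by blast
  moreover have "(act (f i) ^^ 1) m = 0" using m by simp
  ultimately show ?thesis by blast
qed

text \<open>For the reversed triple \<open>m\<close> is a highest vector with eigenvalue
  \<open>- \<nu> (coroot i)\<close>, and \<open>e i\<close> is nilpotent on it.\<close>

lemma lowest_vector_coroot:
  assumes i: "i \<in> I" and m: "m \<in> wspace \<nu>" "m \<noteq> 0" "act (f i) m = 0"
  shows "- \<nu> (coroot i) \<in> \<nat>"
proof -
  obtain n where n: "(act (e i) ^^ n) m = 0" using e_locally_nilpotent[OF i m(1)] by blast
  have "act (- hmap (coroot i)) m = mscale (- \<nu> (coroot i)) m"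
    using m(1) by (simp add: wspace_iff act_uminus_left)
  from sl2_nilpotent[OF sl2_ef(3,4)[OF i] m(3) this m(2) n] show ?thesis .
qed

lemma last_nonzero_power:
  assumes "m \<noteq> 0" "\<exists>n. (act y ^^ n) m = 0"
  obtains p where "(act y ^^ p) m \<noteq> 0" "act y ((act y ^^ p) m) = 0"
proof -
  obtain n where n: "(act y ^^ n) m = 0" using assms by blast
  then have "\<exists>p. (act y ^^ p) m \<noteq> 0 \<and> act y ((act y ^^ p) m) = 0"
  proof (induction n)
    case 0
    then show ?case using assms(1) by simp
  next
    case (Suc n)
    then show ?case by (cases "(act y ^^ n) m = 0") auto
  qed
  then show ?thesis using that by blast
qed

section \<open>Reflections of weights\<close>

lemma integral_coroot:
  assumes "i \<in> J" "\<nu> \<in> wts"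
  obtains c where "\<nu> (coroot i) = of_int c"
proof -
  obtain m where "m \<in> wspace \<nu>" "m \<noteq> 0" using assms(2) wts_iff by blast
  then obtain n where n: "\<nu> = \<Lambda> - root_comb (\<lambda>j. of_nat (n j))"
    using weight_le_highest by blast
  obtain l where l: "\<Lambda> (coroot i) = of_nat l"
    using assms(1) by (auto simp: integrable_indices_def Nats_def)
  have "\<nu> (coroot i) = of_int (int l - (\<Sum>j\<in>I. A i j * int (n j)))"
    using coroot_value[OF _ n, of i] assms(1) J_subset l by auto
  then show ?thesis by (rule that)
qed

text \<open>A single string suffices. For \<open>c \<ge> 0\<close> climb \<open>p\<close> steps to a
  vector killed by \<open>e i\<close>; its eigenvalue is \<open>c + 2 p\<close>, so descending
  \<open>c + p\<close> steps is still nonzero and ends at \<open>\<nu> - c \<alpha> i\<close>. For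
  \<open>c < 0\<close> the same is done upside down, starting from a vector killed by
  \<open>f i\<close>.\<close>

lemma refl_wts:
  assumes i: "i \<in> J" and \<nu>: "\<nu> \<in> wts"
  shows "refl i \<nu> \<in> wts"
proof -
  have iI: "i \<in> I" using i J_subset by auto
  have \<nu>_dual: "\<nu> \<in> dual" using \<nu> by (simp add: weights_def)
  obtain c where c: "\<nu> (coroot i) = of_int c" using integral_coroot[OF i \<nu>] .
  obtain m where m: "m \<in> wspace \<nu>" "m \<noteq> 0" using \<nu> wts_iff by blast
  show ?thesis
  proof (cases "c \<ge> 0")
    case True
    obtain p where p: "(act (e i) ^^ p) m \<noteq> 0" "act (e i) ((act (e i) ^^ p) m) = 0"
      using last_nonzero_power[OF m(2) e_locally_nilpotent[OF iI m(1)]] .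
    define w where "w = (act (e i) ^^ p) m"
    define \<xi> where "\<xi> = \<nu> + fun_scale (of_nat p) (\<alpha> i)"
    have w: "w \<in> wspace \<xi>" unfolding w_def \<xi>_def by (rule act_e_power_wspace[OF iI m(1)])
    have "\<xi> (coroot i) = of_nat (nat c + 2 * p)"
      using True by (simp add: \<xi>_def c root_self[OF iI])
    then have "act (hmap (coroot i)) w = mscale (of_nat (nat c + 2 * p)) w"
      using w by (simp only: wspace_iff)
    then have "(act (f i) ^^ (nat c + p)) w \<noteq> 0"
      using sl2_nonzero[OF sl2_ef(1,2)[OF iI] _ _, of w "nat c + 2 * p" "nat c + p"] p
      by (simp add: w_def)
    moreover have "\<xi> - fun_scale (of_nat (nat c + p)) (\<alpha> i) = refl i \<nu>"
      using True by (intro ext) (simp add: refl_eq[OF \<nu>_dual] c \<xi>_def algebra_simps)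
    ultimately show ?thesis
      using act_f_power_wspace[OF iI w, of "nat c + p"] wts_iff by metis
  next
    case False
    obtain q where q: "(act (f i) ^^ q) m \<noteq> 0" "act (f i) ((act (f i) ^^ q) m) = 0"
      using last_nonzero_power[OF m(2) f_locally_nilpotent[OF i]] .
    define w where "w = (act (f i) ^^ q) m"
    define \<xi> where "\<xi> = \<nu> - fun_scale (of_nat q) (\<alpha> i)"
    have w: "w \<in> wspace \<xi>" unfolding w_def \<xi>_def by (rule act_f_power_wspace[OF iI m(1)])
    have "- \<xi> (coroot i) = of_nat (nat (- c) + 2 * q)"
      using False by (simp add: \<xi>_def c root_self[OF iI])
    moreover have "act (- hmap (coroot i)) w = mscale (- \<xi> (coroot i)) w"
      using w by (simp add: wspace_iff act_uminus_left)
    ultimately have "act (- hmap (coroot i)) w = mscale (of_nat (nat (- c) + 2 * q)) w"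
      by (simp only:)
    then have "(act (e i) ^^ (nat (- c) + q)) w \<noteq> 0"
      using sl2_nonzero[OF sl2_ef(3,4)[OF iI] _ _, of w "nat (- c) + 2 * q" "nat (- c) + q"] q
      by (simp add: w_def)
    moreover have "\<xi> + fun_scale (of_nat (nat (- c) + q)) (\<alpha> i) = refl i \<nu>"
      using False by (intro ext) (simp add: refl_eq[OF \<nu>_dual] c \<xi>_def algebra_simps)
    ultimately show ?thesis
      using act_e_power_wspace[OF iI w, of "nat (- c) + q"] wts_iff by metis
  qed
qed

lemma weight_conjugate_to_dominant:
  assumes "\<nu> \<in> wts"
  shows "\<exists>w\<in>weyl J. \<exists>\<mu>\<in>dominant_for hscale coroot J. weight_le I \<alpha> \<mu> \<Lambda> \<and> \<nu> = w \<mu>"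
proof -
  have "\<exists>w\<in>weyl J. \<exists>\<mu>\<in>dominant_for hscale coroot J. weight_le I \<alpha> \<mu> \<Lambda> \<and> \<nu> = w \<mu>"
    if "\<nu> \<in> wts" "\<nu> = \<Lambda> - root_comb (\<lambda>i. of_nat (n i))" for \<nu> n
    using that
  proof (induction "\<Sum>i\<in>I. n i" arbitrary: \<nu> n rule: less_induct)
    case less
    have \<nu>_dual: "\<nu> \<in> dual" using less.prems(1) by (simp add: weights_def)
    show ?case
    proof (cases "\<forall>i\<in>J. \<nu> (coroot i) \<in> \<nat>")
      case True
      then have "\<nu> \<in> dominant_for hscale coroot J"
        using \<nu>_dual by (simp add: dominant_for_def)
      moreover have "weight_le I \<alpha> \<nu> \<Lambda>" unfolding weight_le_iff using less.prems(2) by blast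
      moreover have "\<nu> = (\<lambda>\<mu>\<in>dual. \<mu>) \<nu>" using \<nu>_dual by simp
      ultimately show ?thesis using weyl_one by blast
    next
      case False
      then obtain i where i: "i \<in> J" "\<nu> (coroot i) \<notin> \<nat>" by blast
      have iI: "i \<in> I" using i J_subset by auto
      obtain c where c: "\<nu> (coroot i) = of_int c" using integral_coroot[OF i(1) less.prems(1)] .
      have "c < 0" using i(2) unfolding c by (metis of_int_of_nat_eq of_nat_in_Nats int_nat_eq not_le)
      have ref: "refl i \<nu> \<in> wts" by (rule refl_wts[OF i(1) less.prems(1)])
      then obtain m where m: "m \<in> wspace (refl i \<nu>)" "m \<noteq> 0" using wts_iff by blast
      obtain n' where n': "refl i \<nu> = \<Lambda> - root_comb (\<lambda>j. of_nat (n' j))"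
        using weight_le_highest[OF m] .
      \<comment> \<open>The reflection changes only the coefficient of \<open>\<alpha> i\<close>, to
        \<open>n i + c\<close> with \<open>c < 0\<close>. It stays natural because the reflected
        weight again lies below \<open>\<Lambda>\<close>, so the depth strictly drops.\<close>
      have "root_comb (\<lambda>j. of_nat (n j) + (if j = i then of_int c else 0)) =
          root_comb (\<lambda>j. of_nat (n j)) + fun_scale (of_int c) (\<alpha> i)"
        by (simp only: root_comb_add root_comb_single[OF iI])
      also have "\<dots> = root_comb (\<lambda>j. of_nat (n' j))"
      proof (rule ext)
        fix x
        have "\<nu> x - of_int c * \<alpha> i x = \<Lambda> x - root_comb (\<lambda>j. of_nat (n' j)) x"
          using fun_cong[OF n', of x] by (simp add: refl_eq[OF \<nu>_dual] c)
        moreover have "\<nu> x = \<Lambda> x - root_comb (\<lambda>j. of_nat (n j)) x"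
          using fun_cong[OF less.prems(2), of x] by simp
        ultimately show "(root_comb (\<lambda>j. of_nat (n j)) + fun_scale (of_int c) (\<alpha> i)) x =
            root_comb (\<lambda>j. of_nat (n' j)) x"
          by (simp add: algebra_simps)
      qed
      finally have coeff: "of_nat (n j) + (if j = i then of_int c else 0) = (of_nat (n' j) :: complex)"
        if "j \<in> I" for j
        using that by (simp only: root_comb_eq_iff)
      have "of_int (int (n j) + (if j = i then c else 0)) = (of_int (int (n' j)) :: complex)"
        if "j \<in> I" for j
        using coeff[OF that] by (cases "j = i") auto
      then have n_eq: "int (n j) + (if j = i then c else 0) = int (n' j)" if "j \<in> I" for j
        using that by (simp only: of_int_eq_iff)
      have "(\<Sum>j\<in>I. n' j) < (\<Sum>j\<in>I. n j)"
      proof (rule sum_strict_mono_ex1[OF finite_I])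
        show "\<forall>j\<in>I. n' j \<le> n j"
        proof
          fix j assume "j \<in> I"
          then show "n' j \<le> n j" using n_eq[of j] \<open>c < 0\<close> by (auto split: if_splits)
        qed
        show "\<exists>j\<in>I. n' j < n j" using n_eq[OF iI] \<open>c < 0\<close> iI by (intro bexI[of _ i]) auto
      qed
      from less.hyps[OF this ref n'] obtain w \<mu> where w: "w \<in> weyl J"
        "\<mu> \<in> dominant_for hscale coroot J" "weight_le I \<alpha> \<mu> \<Lambda>" "refl i \<nu> = w \<mu>"
        by blast
      have "\<mu> \<in> dual" using w(2) by (simp add: dominant_for_def)
      then have "compose dual (refl i) w \<mu> = refl i (refl i \<nu>)" by (simp add: compose_def w(4))
      also have "\<dots> = \<nu>" by (rule refl_refl[OF iI \<nu>_dual])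
      finally have "\<nu> = compose dual (refl i) w \<mu>" ..
      moreover have "compose dual (refl i) w \<in> weyl J"
        by (rule weyl_compose[OF J_subset weyl_refl[OF i(1)] w(1)])
      ultimately show ?thesis using w by blast
    qed
  qed
  then show ?thesis using assms weight_le_highest wts_iff by metis
qed

text \<open>
  Write \<open>\<mu> = \<Lambda> - k\<close> and take a maximal \<open>m \<le> k\<close> for which \<open>\<Lambda> - m\<close> is a weight. On the support
  \<open>D\<close> of \<open>b = k - m\<close> the operators \<open>f i\<close> kill the weight space, which forces \<open>D \<subseteq> J\<close> and makes
  \<open>\<Lambda> - m\<close> antidominant on \<open>D\<close>. If \<open>D\<close> were nonempty, the ratio argument for \<open>m\<close> and \<open>b\<close> would yield
  a block on which \<open>\<Lambda>\<close> vanishes and \<open>b\<close> is antidominant, contradicting the finiteness of the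
  stabilizer.
\<close>

lemma dominant_in_wts:
  assumes fin: "finite {w \<in> weyl J. w \<Lambda> = \<Lambda>}"
    and dom: "\<mu> \<in> dominant_for hscale coroot J" and le: "weight_le I \<alpha> \<mu> \<Lambda>"
  shows "\<mu> \<in> wts"
proof -
  obtain k where k: "\<mu> = \<Lambda> - root_comb (\<lambda>i. of_nat (k i))"
    using le weight_le_iff by blast
  define P where "P m \<longleftrightarrow> (\<forall>i\<in>I. m i \<le> k i) \<and>
      (\<exists>u\<in>wspace (\<Lambda> - root_comb (\<lambda>i. of_nat (m i))). u \<noteq> 0)" for m
  have "\<Lambda> - root_comb (\<lambda>i. of_nat 0) = \<Lambda>" by (rule ext) (simp add: root_comb_apply)
  then have P0: "P (\<lambda>_. 0)" using v_weight v_nonzero unfolding P_def by auto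
  have bound: "\<forall>m. P m \<longrightarrow> (\<Sum>i\<in>I. m i) < Suc (\<Sum>i\<in>I. k i)"
    by (auto simp: P_def less_Suc_eq_le intro: sum_mono)
  obtain m where m: "P m" and max: "\<And>m'. P m' \<Longrightarrow> (\<Sum>i\<in>I. m' i) \<le> (\<Sum>i\<in>I. m i)"
    using ex_has_greatest_nat[where P = P and f = "\<lambda>m. \<Sum>i\<in>I. m i", OF P0 bound] by blast
  define \<nu> where "\<nu> = \<Lambda> - root_comb (\<lambda>i. of_nat (m i))"
  obtain u where u: "u \<in> wspace \<nu>" "u \<noteq> 0" using m by (auto simp: P_def \<nu>_def)
  define D where "D = {i \<in> I. m i < k i}"
  have D_finite: "finite D" and DI: "D \<subseteq> I" using finite_I by (auto simp: D_def)
  have f_u: "act (f i) u = 0" if i: "i \<in> D" for i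
  proof (rule ccontr)
    assume nz: "act (f i) u \<noteq> 0"
    have iI: "i \<in> I" using i by (simp add: D_def)
    define m' where "m' j = m j + (if j = i then 1 else 0)" for j
    have "root_comb (\<lambda>j. of_nat (m' j)) = root_comb (\<lambda>j. of_nat (m j) + (if j = i then 1 else 0))"
      unfolding root_comb_eq_iff by (simp add: m'_def)
    also have "\<dots> = root_comb (\<lambda>j. of_nat (m j)) + \<alpha> i"
      using root_comb_single[OF iI, of 1] by (simp add: root_comb_add fun_eq_iff)
    finally have "\<nu> - \<alpha> i = \<Lambda> - root_comb (\<lambda>j. of_nat (m' j))"
      by (simp add: \<nu>_def diff_diff_eq)
    then have "act (f i) u \<in> wspace (\<Lambda> - root_comb (\<lambda>j. of_nat (m' j)))"
      using act_f_wspace[OF iI u(1)] by metis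
    moreover have "\<forall>j\<in>I. m' j \<le> k j"
      using m i by (auto simp: m'_def P_def D_def)
    ultimately have "P m'" using nz unfolding P_def by blast
    then have "(\<Sum>j\<in>I. m' j) \<le> (\<Sum>j\<in>I. m j)" by (rule max)
    then show False using finite_I iI by (simp add: m'_def sum.distrib)
  qed
  have DJ: "D \<subseteq> J"
    using f_injective f_u u(2) DI by blast
  have "D = {}"
  proof (rule ccontr)
    assume ne: "D \<noteq> {}"
    have "\<forall>i\<in>J. \<exists>l. \<Lambda> (coroot i) = of_nat l"
      by (auto simp: integrable_indices_def Nats_def)
    from bchoice[OF this] obtain L where L: "\<And>i. i \<in> J \<Longrightarrow> \<Lambda> (coroot i) = of_nat (L i)"
      by blast
    define b where "b j = k j - m j" for j
    have b_out: "b j = 0" if "j \<in> I" "j \<notin> D" for j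
      using that by (auto simp: b_def D_def)
    have b_pos: "b j > 0" if "j \<in> D" for j
      using that by (auto simp: b_def D_def)
    have k_eq: "int (k j) = int (m j) + int (b j)" if "j \<in> I" for j
      using m that by (auto simp: b_def P_def)
    have off: "A i j \<le> 0" if "i \<in> I" "j \<in> I" "i \<noteq> j" for i j
      using gcm that by (simp add: generalized_cartan_matrix_def)
    \<comment> \<open>This says \<open>\<nu> (coroot i) \<le> 0\<close>, as \<open>u\<close> is a
      lowest vector for \<open>f i\<close>.\<close>
    have \<nu>_le: "int (L i) \<le> (\<Sum>j\<in>I. A i j * int (m j))" if i: "i \<in> D" for i
    proof -
      have iI: "i \<in> I" and iJ: "i \<in> J" using i DI DJ by auto
      obtain l where "- \<nu> (coroot i) = of_nat l"
        using lowest_vector_coroot[OF iI u f_u[OF i]] by (auto simp: Nats_def)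
      then have "of_int ((\<Sum>j\<in>I. A i j * int (m j)) - int (L i)) = (of_int (int l) :: complex)"
        using coroot_value[OF iI \<nu>_def] L[OF iJ] by simp
      then have "(\<Sum>j\<in>I. A i j * int (m j)) - int (L i) = int l" by (simp only: of_int_eq_iff)
      then show ?thesis by simp
    qed
    have \<mu>_ge: "(\<Sum>j\<in>I. A i j * int (k j)) \<le> int (L i)" if i: "i \<in> D" for i
    proof -
      have iI: "i \<in> I" and iJ: "i \<in> J" using i DI DJ by auto
      obtain l where "\<mu> (coroot i) = of_nat l"
        using dom iJ by (auto simp: dominant_for_def Nats_def)
      then have "of_int (int (L i) - (\<Sum>j\<in>I. A i j * int (k j))) = (of_int (int l) :: complex)"
        using coroot_value[OF iI k] L[OF iJ] by simp
      then have "int (L i) - (\<Sum>j\<in>I. A i j * int (k j)) = int l" by (simp only: of_int_eq_iff)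
      then show ?thesis by simp
    qed
    \<comment> \<open>Subtract: on \<open>D\<close> the weight \<open>\<mu>\<close> is dominant,
      \<open>\<nu>\<close> antidominant, and \<open>b\<close> collects the coefficients of
      \<open>\<nu> - \<mu>\<close>.\<close>
    have b_D: "(\<Sum>j\<in>D. A i j * int (b j)) \<le> 0" if i: "i \<in> D" for i
    proof -
      have "(\<Sum>j\<in>I. A i j * int (k j)) = (\<Sum>j\<in>I. A i j * int (m j)) + (\<Sum>j\<in>I. A i j * int (b j))"
        by (simp add: k_eq distrib_left sum.distrib cong: sum.cong)
      moreover have "(\<Sum>j\<in>I. A i j * int (b j)) = (\<Sum>j\<in>D. A i j * int (b j))"
        by (rule sum.mono_neutral_right) (use finite_I DI b_out in auto)
      ultimately show ?thesis using \<nu>_le[OF i] \<mu>_ge[OF i] by linarith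
    qed
    \<comment> \<open>Columns outside \<open>D\<close> are off-diagonal for a row in
      \<open>D\<close>, so dropping them can only increase the sum.\<close>
    have m_D: "int (L i) \<le> (\<Sum>j\<in>D. A i j * int (m j))" if i: "i \<in> D" for i
    proof -
      have "(\<Sum>j\<in>I. A i j * int (m j)) =
          (\<Sum>j\<in>I - D. A i j * int (m j)) + (\<Sum>j\<in>D. A i j * int (m j))"
        by (rule sum.subset_diff[OF DI finite_I])
      moreover have "(\<Sum>j\<in>I - D. A i j * int (m j)) \<le> 0"
        by (rule sum_nonpos) (use i DI off in \<open>auto intro!: mult_nonpos_nonneg\<close>)
      ultimately show ?thesis using \<nu>_le[OF i] by linarith
    qed
    obtain Z where Z: "Z \<subseteq> D" "Z \<noteq> {}" "\<And>i j. i \<in> Z \<Longrightarrow> j \<in> D - Z \<Longrightarrow> real_of_int (A i j) = 0"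
      "\<And>i. i \<in> Z \<Longrightarrow> (\<Sum>j\<in>D. real_of_int (A i j) * real (m j)) = 0"
    proof (rule minimal_ratio_block[OF D_finite ne, of "\<lambda>i j. real_of_int (A i j)" "\<lambda>j. real (m j)"
          "\<lambda>j. real (b j)"])
      fix i assume i: "i \<in> D"
      show "(\<Sum>j\<in>D. real_of_int (A i j) * real (b j)) \<le> 0"
        using b_D[OF i] of_int_le_0_iff[of "\<Sum>j\<in>D. A i j * int (b j)", where 'a = real] by simp
      show "(\<Sum>j\<in>D. real_of_int (A i j) * real (m j)) \<ge> 0"
        using m_D[OF i] of_int_0_le_iff[of "\<Sum>j\<in>D. A i j * int (m j)", where 'a = real] by simp
    qed (use off DI b_pos in auto)
    \<comment> \<open>Here \<open>\<Lambda>\<close> is squeezed: \<open>0 \<le> L i \<le>\<close>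
      the row of \<open>m\<close>, which vanishes on \<open>Z\<close>.\<close>
    have ZL: "L i = 0" if i: "i \<in> Z" for i
    proof -
      have "real_of_int (\<Sum>j\<in>D. A i j * int (m j)) = 0" using Z(4)[OF i] by simp
      then have "(\<Sum>j\<in>D. A i j * int (m j)) = 0" by (simp only: of_int_eq_0_iff)
      then show ?thesis using m_D[of i] i Z(1) by auto
    qed
    \<comment> \<open>Rows in \<open>Z\<close> vanish on \<open>D - Z\<close>, so truncating
      \<open>b\<close> to \<open>Z\<close> leaves their sums unchanged.\<close>
    define b' where "b' j = (if j \<in> Z then b j else 0)" for j
    obtain z where z: "z \<in> Z" using Z(2) by blast
    have "b' z = 0"
    proof (rule finite_stabilizer_positive[OF J_subset \<Lambda>_dual fin])
      show "z \<in> I" using z Z(1) DI by auto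
      fix i assume "i \<in> I" "b' i > 0"
      then have i: "i \<in> Z" by (simp add: b'_def split: if_splits)
      then have iD: "i \<in> D" and iJ: "i \<in> J" using Z(1) DJ by auto
      have "(\<Sum>j\<in>I. A i j * int (b' j)) = (\<Sum>j\<in>D. A i j * int (b' j))"
        by (rule sum.mono_neutral_right) (use finite_I DI Z(1) in \<open>auto simp: b'_def\<close>)
      also have "\<dots> = (\<Sum>j\<in>D. A i j * int (b j))"
        by (rule sum.cong) (use Z(3)[OF i] in \<open>auto simp: b'_def\<close>)
      also have "\<dots> \<le> 0" by (rule b_D[OF iD])
      finally show "i \<in> J \<and> \<Lambda> (coroot i) = 0 \<and> (\<Sum>j\<in>I. A i j * int (b' j)) \<le> 0"
        using iJ L[OF iJ] ZL[OF i] by simp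
    qed
    then show False using z b_pos[of z] Z(1) by (auto simp: b'_def)
  qed
  then have "\<forall>i\<in>I. m i = k i"
    using m by (force simp: D_def P_def)
  then have "root_comb (\<lambda>i. of_nat (m i)) = root_comb (\<lambda>i. of_nat (k i))"
    by (simp add: root_comb_eq_iff)
  then have "\<nu> = \<mu>" unfolding \<nu>_def k by (simp only:)
  then show ?thesis using u wts_iff by blast
qed

theorem wts_eq:
  assumes "finite {w \<in> weyl J. w \<Lambda> = \<Lambda>}"
  shows "wts = {w \<mu> | w \<mu>.
    w \<in> weyl J \<and> \<mu> \<in> dominant_for hscale coroot J \<and> weight_le I \<alpha> \<mu> \<Lambda>}"
proof (intro equalityI subsetI)
  fix \<nu> assume "\<nu> \<in> wts"
  from weight_conjugate_to_dominant[OF this]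
  show "\<nu> \<in> {w \<mu> | w \<mu>.
    w \<in> weyl J \<and> \<mu> \<in> dominant_for hscale coroot J \<and> weight_le I \<alpha> \<mu> \<Lambda>}"
    by blast
next
  fix \<nu> assume "\<nu> \<in> {w \<mu> | w \<mu>.
    w \<in> weyl J \<and> \<mu> \<in> dominant_for hscale coroot J \<and> weight_le I \<alpha> \<mu> \<Lambda>}"
  then obtain w \<mu> where w: "w \<in> weyl J" "\<mu> \<in> wts" "\<nu> = w \<mu>"
    using dominant_in_wts[OF assms] by blast
  have "wts \<subseteq> dual" by (auto simp: weights_def)
  from weyl_preserves[OF w(1) J_subset this refl_wts w(2)] show "\<nu> \<in> wts"
    by (simp only: w(3))
qed

end

theorem proposition2p7:
  fixes hscale :: "complex \<Rightarrow> 'h::ab_group_add \<Rightarrow> 'h"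
    and I :: "'i set"
    and A :: "'i \<Rightarrow> 'i \<Rightarrow> int"
    and \<alpha> :: "'i \<Rightarrow> 'h \<Rightarrow> complex"
    and coroot :: "'i \<Rightarrow> 'h"
    and gscale :: "complex \<Rightarrow> 'g::ab_group_add \<Rightarrow> 'g"
    and bracket :: "'g \<Rightarrow> 'g \<Rightarrow> 'g"
    and hmap :: "'h \<Rightarrow> 'g"
    and e f :: "'i \<Rightarrow> 'g"
    and \<Lambda> :: "'h \<Rightarrow> complex"
    and mscale :: "complex \<Rightarrow> 'm::ab_group_add \<Rightarrow> 'm"
    and act :: "'g \<Rightarrow> 'm \<Rightarrow> 'm"
  assumes "kac_moody_algebra hscale I A \<alpha> coroot gscale bracket hmap e f"
    and "\<Lambda> \<in> dual_space hscale"
    and "lie_module gscale bracket mscale act"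
    and "highest_weight_module I hmap e mscale act \<Lambda>"
    and "simple_module mscale act"
    and "finite {w \<in> parabolic_weyl_group hscale \<alpha> coroot (integrable_indices I coroot \<Lambda>).
                   w \<Lambda> = \<Lambda>}"
  shows "weights hscale mscale (\<lambda>x. act (hmap x)) =
    {w \<mu> | w \<mu>.
       w \<in> parabolic_weyl_group hscale \<alpha> coroot (integrable_indices I coroot \<Lambda>) \<and>
       \<mu> \<in> dominant_for hscale coroot (integrable_indices I coroot \<Lambda>) \<and>
       weight_le I \<alpha> \<mu> \<Lambda>}"
proof -
  obtain v where v: "v \<noteq> 0" "v \<in> weight_space mscale (\<lambda>x. act (hmap x)) \<Lambda>"
    "\<forall>i\<in>I. act (e i) v = 0"
    using assms(4) unfolding highest_weight_module_def by blast
  interpret kac_moody_module hscale I A \<alpha> coroot gscale bracket hmap e f mscale act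
    using assms(1,3) by (rule kac_moody_module.intro)
  interpret simple_highest_weight_module hscale I A \<alpha> coroot gscale bracket hmap e f mscale act \<Lambda> v
    by unfold_locales (use assms(2,5) v in auto)
  show ?thesis by (rule wts_eq[OF assms(6)])
qed

end
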